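(* For each $n$ let $M_n$ be a deterministic $n\times n$ Hermitian matrix with eigenvalues $a_1^{(n)},\dots,a_n^{(n)}$ such that $\mu_n=\frac1n\sum_{k=1}^n\delta_{a_k^{(n)}}$ and $\mu$ satisfy Assumptions 1 and 2, let $H_n$ be an $n\times n$ GUE matrix, and let $Y_n(t)=M_n+\sqrt t\,H_n$. Let $\delta_n>0$ be a sequence converging to $0$ such that $n\delta_n^2\to\infty$ as $n\to\infty$, and suppose that $x^*\in\mathbb R$ is such that the intervals $[x^*-\delta_n,x^*+\delta_n]$ do not contain any of the points $a_1^{(n)},\dots,a_n^{(n)}$. Let $\epsilon_n>0$ with $\epsilon_n=o(\delta_n)$ and $t_n>0$ with $t_n=o(\delta_n^2)$ as $n\to\infty$. Then $$\lim_{n\to\infty}\mathrm{Prob}\left(Y_n(t_n)\text{ has no eigenvalues in }[x^*_{t_n}-\epsilon_n,\,x^*_{t_n}+\epsilon_n]\right)=1.$$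
   Context: Assumption 1: as $n\to\infty$, $\mu_n$ converges weakly to an absolutely continuous probability measure $\mu$ with compact support, whose density $\psi$ is continuous as a function restricted to the support. Assumption 2: there is a compact subset of $\mathbb R$ containing the points $a_j^{(n)}$ for all $j$ and all $n$. GUE: $H_n$ has density proportional to $e^{-\frac n2\mathrm{Tr}(H^2)}$ with respect to Lebesgue measure on the space of $n\times n$ complex Hermitian matrices. Notation: for $t>0$, $y_{t,\mu}(x)=\inf\{y>0:\int\frac{d\mu(s)}{(x-s)^2+y^2}\le\frac1t\}$, and $x^*_t:=x^*+t\int\frac{(x^*-u)\psi(u)\,du}{(x^*-u)^2+y_{t,\mu}(x^* )^2}$. *)

theory Defs
  imports
    "HOL-Probability.Probability"
    "HOL-Library.Landau_Symbols"
    "Jordan_Normal_Form.Char_Poly"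
    "Jordan_Normal_Form.Schur_Decomposition"
begin

section \<open>Hermitian matrices\<close>

definition hermitian_mats :: "nat \<Rightarrow> complex mat set" where
  "hermitian_mats n = {A \<in> carrier_mat n n. mat_adjoint A = A}"

definition mat_trace :: "complex mat \<Rightarrow> complex" where
  "mat_trace A = (\<Sum>i<dim_row A. A $$ (i, i))"

text \<open>The eigenvalues are listed with their algebraic multiplicities.\<close>

definition eigenvalues_listed :: "complex mat \<Rightarrow> nat \<Rightarrow> (nat \<Rightarrow> real) \<Rightarrow> bool" where
  "eigenvalues_listed A n a \<longleftrightarrow>
     A \<in> carrier_mat n n \<and> char_poly A = (\<Prod>k<n. [:- complex_of_real (a k), 1:])"

section \<open>Lebesgue measure on Hermitian matrices and the GUE\<close>

text \<open>The type of matrices contains matrices of all dimensions and carries no topology, so the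
  Borel structure on the \<open>n \<times> n\<close> Hermitian matrices is the one generated by the matrix entries.\<close>

definition mat_entries :: "nat \<Rightarrow> complex mat \<Rightarrow> nat \<times> nat \<Rightarrow> complex" where
  "mat_entries n A = (\<lambda>ij \<in> {..<n} \<times> {..<n}. A $$ ij)"

definition hermitian_borel :: "nat \<Rightarrow> complex mat measure" where
  "hermitian_borel n =
     vimage_algebra (hermitian_mats n) (mat_entries n) (Pi\<^sub>M ({..<n} \<times> {..<n}) (\<lambda>_. borel))"

text \<open>The \<open>n\<^sup>2\<close> real coordinates of a Hermitian matrix are its diagonal entries \<open>x (i, i)\<close> and, for
  \<open>i < j\<close>, the real part \<open>x (i, j)\<close> and the imaginary part \<open>x (j, i)\<close> of the entry \<open>(i, j)\<close>.\<close>

definition herm_of_coords :: "nat \<Rightarrow> (nat \<times> nat \<Rightarrow> real) \<Rightarrow> complex mat" where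
  "herm_of_coords n x = Matrix.mat n n (\<lambda>(i, j).
     if i = j then complex_of_real (x (i, i))
     else if i < j then Complex (x (i, j)) (x (j, i))
     else Complex (x (j, i)) (- x (i, j)))"

definition hermitian_lebesgue :: "nat \<Rightarrow> complex mat measure" where
  "hermitian_lebesgue n =
     distr (Pi\<^sub>M ({..<n} \<times> {..<n}) (\<lambda>_. lborel)) (hermitian_borel n) (herm_of_coords n)"

text \<open>The constant \<open>c\<close> is determined by the total mass being 1. The trace of \<open>A\<^sup>2\<close> is real for
  Hermitian \<open>A\<close>.\<close>

definition is_GUE :: "nat \<Rightarrow> 'w measure \<Rightarrow> ('w \<Rightarrow> complex mat) \<Rightarrow> bool" where
  "is_GUE n \<Omega> H \<longleftrightarrow> prob_space \<Omega> \<and>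
     (\<exists>c>0. distributed \<Omega> (hermitian_lebesgue n) H
        (\<lambda>A. ennreal (c * exp (- (real n / 2) * Re (mat_trace (A * A))))))"

lemma mat_adjoint_index:
  assumes "A \<in> carrier_mat n n" "i < n" "j < n"
  shows "mat_adjoint (A :: complex mat) $$ (i, j) = cnj (A $$ (j, i))"
  using assms by (simp add: mat_adjoint_def mat_of_rows_def cols_nth)

lemma hermitian_mats_iff:
  "A \<in> hermitian_mats n \<longleftrightarrow>
     A \<in> carrier_mat n n \<and> (\<forall>i<n. \<forall>j<n. A $$ (i, j) = cnj (A $$ (j, i)))"
proof (cases "A \<in> carrier_mat n n")
  case True
  have "mat_adjoint A \<in> carrier_mat n n"
    using True by (simp add: mat_adjoint_def mat_of_rows_def)
  then have "mat_adjoint A = A \<longleftrightarrow> (\<forall>i<n. \<forall>j<n. mat_adjoint A $$ (i, j) = A $$ (i, j))"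
    using True by (metis carrier_matD(1) carrier_matD(2) eq_matI)
  also have "\<dots> \<longleftrightarrow> (\<forall>i<n. \<forall>j<n. A $$ (i, j) = cnj (A $$ (j, i)))"
    using mat_adjoint_index[OF True] by metis
  finally show ?thesis
    using True unfolding hermitian_mats_def by blast
next
  case False
  then show ?thesis unfolding hermitian_mats_def by blast
qed

lemma bij_betw_herm_of_coords:
  "bij_betw (herm_of_coords n) (({..<n} \<times> {..<n}) \<rightarrow>\<^sub>E UNIV) (hermitian_mats n)"
proof -
  define g :: "complex mat \<Rightarrow> nat \<times> nat \<Rightarrow> real" where
    "g A = (\<lambda>(i, j) \<in> {..<n} \<times> {..<n}. if i \<le> j then Re (A $$ (i, j)) else Im (A $$ (j, i)))" for A
  show ?thesis
  proof (rule bij_betw_byWitness[where f' = g])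
    show "\<forall>x \<in> ({..<n} \<times> {..<n}) \<rightarrow>\<^sub>E UNIV. g (herm_of_coords n x) = x"
      by (auto simp: g_def herm_of_coords_def fun_eq_iff PiE_def extensional_def)
    show "\<forall>A \<in> hermitian_mats n. herm_of_coords n (g A) = A"
    proof
      fix A assume A: "A \<in> hermitian_mats n"
      then have C: "A \<in> carrier_mat n n"
        and H: "\<And>i j. i < n \<Longrightarrow> j < n \<Longrightarrow> A $$ (i, j) = cnj (A $$ (j, i))"
        unfolding hermitian_mats_iff by blast+
      show "herm_of_coords n (g A) = A"
      proof (rule eq_matI)
        fix i j assume "i < dim_row A" "j < dim_col A"
        then have ij: "i < n" "j < n" using C by auto
        have "Re (A $$ (i, j)) = Re (A $$ (j, i))" "Im (A $$ (i, j)) = - Im (A $$ (j, i))"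
          using arg_cong[OF H[OF ij], of Re] arg_cong[OF H[OF ij], of Im] by auto
        then show "herm_of_coords n (g A) $$ (i, j) = A $$ (i, j)"
          using ij by (auto simp: herm_of_coords_def g_def complex_eq_iff)
      qed (use C in \<open>auto simp: herm_of_coords_def\<close>)
    qed
    show "herm_of_coords n ` (({..<n} \<times> {..<n}) \<rightarrow>\<^sub>E UNIV) \<subseteq> hermitian_mats n"
      by (auto simp: hermitian_mats_iff herm_of_coords_def complex_eq_iff)
    show "g ` hermitian_mats n \<subseteq> ({..<n} \<times> {..<n}) \<rightarrow>\<^sub>E UNIV"
      unfolding g_def by (intro image_subsetI restrict_PiE_iff[THEN iffD2]) auto
  qed
qed

lemma measurable_herm_of_coords:
  "herm_of_coords n \<in> Pi\<^sub>M ({..<n} \<times> {..<n}) (\<lambda>_. lborel) \<rightarrow>\<^sub>M hermitian_borel n"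
  unfolding hermitian_borel_def
proof (rule measurable_vimage_algebra2)
  show "herm_of_coords n \<in> space (Pi\<^sub>M ({..<n} \<times> {..<n}) (\<lambda>_. lborel)) \<rightarrow> hermitian_mats n"
    using bij_betw_imp_surj_on[OF bij_betw_herm_of_coords[of n]] by (auto simp: space_PiM)
  have [measurable]: "(\<lambda>x. Complex (f x) (g x)) \<in> borel_measurable M"
    if [measurable]: "f \<in> borel_measurable M" "g \<in> borel_measurable M"
    for M :: "(nat \<times> nat \<Rightarrow> real) measure" and f g
    by (simp add: Complex_eq)
  have coord [measurable]: "(\<lambda>x. x ij) \<in> borel_measurable (Pi\<^sub>M ({..<n} \<times> {..<n}) (\<lambda>_. lborel :: real measure))"
    if "ij \<in> {..<n} \<times> {..<n}" for ij
    using measurable_component_singleton[OF that, of "\<lambda>_. lborel :: real measure"] by simp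
  show "(\<lambda>x. mat_entries n (herm_of_coords n x))
      \<in> Pi\<^sub>M ({..<n} \<times> {..<n}) (\<lambda>_. lborel) \<rightarrow>\<^sub>M Pi\<^sub>M ({..<n} \<times> {..<n}) (\<lambda>_. borel)"
    unfolding mat_entries_def
  proof (rule measurable_restrict)
    fix ij assume ij: "ij \<in> {..<n} \<times> {..<n}"
    obtain i j where [simp]: "ij = (i, j)" by force
    have "i < n" "j < n" using ij by auto
    then show "(\<lambda>x. herm_of_coords n x $$ ij)
        \<in> borel_measurable (Pi\<^sub>M ({..<n} \<times> {..<n}) (\<lambda>_. lborel))"
      unfolding herm_of_coords_def
      by (cases "i = j"; cases "i < j") (auto intro!: measurable_compose[OF coord] coord)
  qed
qed

section \<open>The limiting measure\<close>

definition empirical_measure :: "nat \<Rightarrow> (nat \<Rightarrow> real) \<Rightarrow> real measure" where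
  "empirical_measure n a = distr (uniform_count_measure {..<n}) borel a"

lemma emeasure_empirical_measure:
  assumes "n > 0" "A \<in> sets borel"
  shows "emeasure (empirical_measure n a) A = ennreal (1 / n * (\<Sum>k<n. indicator A (a k)))"
proof -
  have "emeasure (empirical_measure n a) A = emeasure (uniform_count_measure {..<n}) {k \<in> {..<n}. a k \<in> A}"
    unfolding empirical_measure_def using assms
    by (subst emeasure_distr)
       (auto simp: space_uniform_count_measure measurable_def sets_uniform_count_measure
             intro!: arg_cong2[where f = emeasure])
  also have "\<dots> = ennreal (card {k \<in> {..<n}. a k \<in> A} / n)"
    using assms by (subst emeasure_uniform_count_measure) auto
  also have "real (card {k \<in> {..<n}. a k \<in> A}) = (\<Sum>k<n. indicator A (a k))"
    by (subst sum.mono_neutral_right[of "{..<n}" "{k \<in> {..<n}. a k \<in> A}"]) (auto simp: indicator_def)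
  finally show ?thesis by simp
qed

definition measure_support :: "real measure \<Rightarrow> real set" where
  "measure_support \<mu> = {x. \<forall>U. open U \<longrightarrow> x \<in> U \<longrightarrow> emeasure \<mu> U > 0}"

definition assumption_1 :: "(nat \<Rightarrow> real measure) \<Rightarrow> real measure \<Rightarrow> (real \<Rightarrow> real) \<Rightarrow> bool" where
  "assumption_1 \<mu>n \<mu> \<psi> \<longleftrightarrow>
     prob_space \<mu> \<and>
     weak_conv_m \<mu>n \<mu> \<and>
     \<psi> \<in> borel_measurable borel \<and> (\<forall>x. \<psi> x \<ge> 0) \<and> \<mu> = density lborel (\<lambda>x. ennreal (\<psi> x)) \<and>
     compact (measure_support \<mu>) \<and> continuous_on (measure_support \<mu>) \<psi>"

definition assumption_2 :: "(nat \<Rightarrow> nat \<Rightarrow> real) \<Rightarrow> bool" where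
  "assumption_2 a \<longleftrightarrow> (\<exists>K. compact K \<and> (\<forall>n\<ge>1. \<forall>k<n. a n k \<in> K))"

definition y_fun :: "real \<Rightarrow> real measure \<Rightarrow> real \<Rightarrow> real" where
  "y_fun t \<mu> x = Inf {y. y > 0 \<and> (\<integral>s. 1 / ((x - s)\<^sup>2 + y\<^sup>2) \<partial>\<mu>) \<le> 1 / t}"

definition x_star_t :: "real \<Rightarrow> real measure \<Rightarrow> (real \<Rightarrow> real) \<Rightarrow> real \<Rightarrow> real" where
  "x_star_t t \<mu> \<psi> x =
     x + t * (\<integral>u. (x - u) * \<psi> u / ((x - u)\<^sup>2 + (y_fun t \<mu> x)\<^sup>2) \<partial>lborel)"

end

theory Submission
  imports Defs "Jordan_Normal_Form.Spectral_Radius" "HOL-Real_Asymp.Real_Asymp"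
begin

unbundle no vec_syntax

text \<open>The shift from \<open>x\<close> to \<open>x\<^sub>t\<close> is at most \<open>sqrt t\<close>, because \<open>y_fun\<close> bounds the integral of
  \<open>1 / ((x - u)\<^sup>2 + y\<^sup>2)\<close> by \<open>1 / t\<close>. So the window stays at distance \<open>\<delta> / 2\<close> from the spectrum of
  \<open>M\<close>, and an eigenvalue in it, with eigenvector \<open>v\<close>, forces \<open>sqrt t |H v| \<ge> (\<delta> / 2) |v|\<close>. Since
  \<open>sqrt t = o(\<delta>)\<close>, it is enough that the operator norm of the GUE matrix is at most 40 with
  probability tending to 1. That follows from a union bound: completing the square in the density
  bounds the exponential moments of \<open>Re (u\<^sup>* H v)\<close>, and this bilinear form on the ball of radius
  \<open>sqrt n\<close> is dominated by its values on pairs of Gaussian-integer vectors of squared length at most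
  \<open>6 n\<close>, of which there are only exponentially many: rounding each coordinate up or down according
  to the sign of its coefficient never decreases a linear form.\<close>

section \<open>Hermitian matrices and the distance to the spectrum\<close>

text \<open>Acts on coordinate functions rather than on vectors, so that \<open>vec_index v\<close>,
  residuals written as lambda terms and the integer points of the net are all measured by one
  notion.\<close>

definition sq_nrm :: "nat \<Rightarrow> (nat \<Rightarrow> complex) \<Rightarrow> real" where
  "sq_nrm n u = (\<Sum>i<n. (cmod (u i))\<^sup>2)"

definition vip :: "nat \<Rightarrow> complex Matrix.vec \<Rightarrow> complex Matrix.vec \<Rightarrow> complex" where
  "vip n u v = (\<Sum>i<n. cnj (u $ i) * v $ i)"

lemma sq_nrm_nonneg [simp]: "sq_nrm n u \<ge> 0"
  by (simp add: sq_nrm_def sum_nonneg)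

lemma vip_self: "vip n u u = complex_of_real (sq_nrm n (vec_index u))"
  unfolding vip_def sq_nrm_def of_real_sum complex_norm_square
  by (simp add: mult.commute)

lemma cmod_vip_le: "(cmod (vip n u v))\<^sup>2 \<le> sq_nrm n (vec_index u) * sq_nrm n (vec_index v)"
proof -
  have "cmod (vip n u v) \<le> (\<Sum>i<n. cmod (u $ i) * cmod (v $ i))"
    unfolding vip_def by (rule order.trans[OF norm_sum]) (simp add: norm_mult)
  then have "(cmod (vip n u v))\<^sup>2 \<le> (\<Sum>i<n. cmod (u $ i) * cmod (v $ i))\<^sup>2"
    by (rule power_mono) simp
  also have "\<dots> \<le> sq_nrm n (vec_index u) * sq_nrm n (vec_index v)"
    unfolding sq_nrm_def by (rule Cauchy_Schwarz_ineq_sum)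
  finally show ?thesis .
qed

lemma mat_vec_index:
  assumes "A \<in> carrier_mat n n" "v \<in> carrier_vec n" "i < n"
  shows "(A *\<^sub>v v) $ i = (\<Sum>j<n. A $$ (i, j) * v $ j)"
  using assms by (auto simp: scalar_prod_def atLeast0LessThan intro!: sum.cong)

lemma vip_hermitian:
  assumes A: "A \<in> hermitian_mats n" and u: "u \<in> carrier_vec n" and v: "v \<in> carrier_vec n"
  shows "vip n (A *\<^sub>v u) v = vip n u (A *\<^sub>v v)"
proof -
  have C: "A \<in> carrier_mat n n" and H: "\<And>i j. i < n \<Longrightarrow> j < n \<Longrightarrow> cnj (A $$ (i, j)) = A $$ (j, i)"
    using A unfolding hermitian_mats_iff by (blast, metis complex_cnj_cnj)
  have "vip n (A *\<^sub>v u) v = (\<Sum>i<n. \<Sum>j<n. cnj (u $ j) * (A $$ (j, i) * v $ i))"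
    unfolding vip_def
  proof (intro sum.cong refl)
    fix i assume "i \<in> {..<n}"
    then have "cnj ((A *\<^sub>v u) $ i) = (\<Sum>j<n. A $$ (j, i) * cnj (u $ j))"
      using H by (simp add: mat_vec_index[OF C u])
    then show "cnj ((A *\<^sub>v u) $ i) * v $ i = (\<Sum>j<n. cnj (u $ j) * (A $$ (j, i) * v $ i))"
      by (simp add: sum_distrib_left sum_distrib_right mult_ac)
  qed
  also have "\<dots> = (\<Sum>j<n. \<Sum>i<n. cnj (u $ j) * (A $$ (j, i) * v $ i))"
    by (rule sum.swap)
  also have "\<dots> = vip n u (A *\<^sub>v v)"
    unfolding vip_def using mat_vec_index[OF C v] by (auto simp: sum_distrib_left intro!: sum.cong)
  finally show ?thesis .
qed

text \<open>Cauchy-Schwarz in each row. The loss of a factor of order \<open>n\<close> squared is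
  harmless: the bound is applied to the powers of one fixed matrix, where only the dependence on the
  exponent matters.\<close>

lemma sq_nrm_mat_vec_le:
  assumes A: "A \<in> carrier_mat n n" and v: "v \<in> carrier_vec n" and b: "norm_bound A b"
  shows "sq_nrm n (vec_index (A *\<^sub>v v)) \<le> real n * (real n * b\<^sup>2) * sq_nrm n (vec_index v)"
proof -
  have "(cmod ((A *\<^sub>v v) $ i))\<^sup>2 \<le> (real n * b\<^sup>2) * sq_nrm n (vec_index v)" if i: "i < n" for i
  proof -
    have "cmod ((A *\<^sub>v v) $ i) \<le> (\<Sum>j<n. cmod (A $$ (i, j)) * cmod (v $ j))"
      unfolding mat_vec_index[OF A v i] by (rule order.trans[OF norm_sum]) (simp add: norm_mult)
    then have "(cmod ((A *\<^sub>v v) $ i))\<^sup>2 \<le> (\<Sum>j<n. cmod (A $$ (i, j)) * cmod (v $ j))\<^sup>2"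
      by (rule power_mono) simp
    also have "\<dots> \<le> (\<Sum>j<n. (cmod (A $$ (i, j)))\<^sup>2) * sq_nrm n (vec_index v)"
      unfolding sq_nrm_def by (rule Cauchy_Schwarz_ineq_sum)
    also have "\<dots> \<le> (\<Sum>j<n. b\<^sup>2) * sq_nrm n (vec_index v)"
      using A b i by (intro mult_right_mono sum_mono power_mono) (auto simp: norm_bound_def)
    finally show ?thesis by simp
  qed
  then have "sq_nrm n (vec_index (A *\<^sub>v v)) \<le> (\<Sum>i<n. (real n * b\<^sup>2) * sq_nrm n (vec_index v))"
    unfolding sq_nrm_def[of n "vec_index (A *\<^sub>v v)"] by (intro sum_mono) auto
  then show ?thesis by simp
qed

text \<open>For Hermitian \<open>A\<close> the sequence \<open>|A^k v|^2\<close> is log-convex, so an initial increase would force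
  exponential growth, against the polynomial bound on the powers of \<open>A\<close>.\<close>

lemma hermitian_contraction:
  assumes A: "A \<in> hermitian_mats n" and ev: "\<And>e. eigenvalue A e \<Longrightarrow> cmod e \<le> 1"
    and n: "n > 0" and v: "v \<in> carrier_vec n"
  shows "sq_nrm n (vec_index (A *\<^sub>v v)) \<le> sq_nrm n (vec_index v)"
proof (rule ccontr)
  assume neg: "\<not> ?thesis"
  have C: "A \<in> carrier_mat n n" using A by (simp add: hermitian_mats_iff)
  define w where "w k = (((*\<^sub>v) A) ^^ k) v" for k
  define q where "q k = sq_nrm n (vec_index (w k))" for k
  have car: "w k \<in> carrier_vec n" for k
    by (induction k) (use C v in \<open>auto simp: w_def\<close>)
  have step: "w (Suc k) = A *\<^sub>v w k" for k
    by (simp add: w_def)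
  have pw: "A ^\<^sub>m k \<in> carrier_mat n n" for k using C by simp
  have "u \<in> carrier_vec n \<Longrightarrow> (A ^\<^sub>m k) *\<^sub>v u = (((*\<^sub>v) A) ^^ k) u" for k u
  proof (induction k arbitrary: u)
    case (Suc k)
    have "A ^\<^sub>m Suc k *\<^sub>v u = A ^\<^sub>m k *\<^sub>v (A *\<^sub>v u)"
      using assoc_mult_mat_vec[OF pw C Suc.prems] by simp
    also have "\<dots> = (((*\<^sub>v) A) ^^ k) (A *\<^sub>v u)"
      using Suc.prems C by (intro Suc.IH) simp
    finally show ?case by (simp add: funpow_swap1)
  qed (use C in simp)
  then have w_pow: "w k = (A ^\<^sub>m k) *\<^sub>v v" for k
    using v by (simp add: w_def)
  have q0: "q 0 = sq_nrm n (vec_index v)" and q1: "q (Suc 0) = sq_nrm n (vec_index (A *\<^sub>v v))"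
    by (simp_all add: q_def w_def)
  \<comment> \<open>One factor \<open>A\<close> moves across the inner product, from the left
    argument to the right one; Cauchy-Schwarz then separates \<open>w k\<close> from
    \<open>w (Suc (Suc k))\<close>.\<close>
  have logconv: "(q (Suc k))\<^sup>2 \<le> q k * q (Suc (Suc k))" for k
  proof -
    have "complex_of_real (q (Suc k)) = vip n (A *\<^sub>v (w k)) (w (Suc k))"
      unfolding q_def vip_self[symmetric] by (simp only: step)
    also have "\<dots> = vip n (w k) (w (Suc (Suc k)))"
      unfolding step[of "Suc k"] by (subst vip_hermitian[OF A car car]) (rule refl)
    finally have "(cmod (complex_of_real (q (Suc k))))\<^sup>2 \<le> q k * q (Suc (Suc k))"
      unfolding q_def using cmod_vip_le by metis
    then show ?thesis by simp
  qed
  have q0_pos: "q 0 > 0"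
  proof (rule ccontr)
    assume "\<not> q 0 > 0"
    then have "q 0 = 0" using sq_nrm_nonneg[of n "vec_index v"] q0 by simp
    then have z: "\<forall>i<n. v $ i = 0"
      unfolding q0 sq_nrm_def by (subst (asm) sum_nonneg_eq_0_iff) auto
    then have "sq_nrm n (vec_index (A *\<^sub>v v)) = 0"
      unfolding sq_nrm_def by (intro sum.neutral ballI) (simp add: mat_vec_index[OF C v])
    then show False using neg sq_nrm_nonneg[of n "vec_index v"] by simp
  qed
  define r where "r = q (Suc 0) / q 0"
  have r: "r > 1" using neg q0_pos by (simp add: r_def q0 q1)
  have inc: "q k > 0 \<and> q (Suc k) \<ge> r * q k" for k
  proof (induction k)
    case 0
    then show ?case using q0_pos by (simp add: r_def)
  next
    case (Suc k)
    have pos: "q (Suc k) > 0"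
      using Suc r by (smt (verit) mult_pos_pos)
    have "q k * (r * q (Suc k)) = (r * q k) * q (Suc k)" by simp
    also have "\<dots> \<le> q (Suc k) * q (Suc k)"
      using Suc pos by (intro mult_right_mono) auto
    also have "\<dots> \<le> q k * q (Suc (Suc k))"
      using logconv[of k] by (simp add: power2_eq_square)
    finally have "r * q (Suc k) \<le> q (Suc (Suc k))"
      using Suc by (subst (asm) mult_le_cancel_left_pos) auto
    with pos show ?case by simp
  qed
  have growth: "r ^ k * q 0 \<le> q k" for k
  proof (induction k)
    case (Suc k)
    have "r ^ Suc k * q 0 = r * (r ^ k * q 0)" by simp
    also have "\<dots> \<le> r * q k" using Suc r by (intro mult_left_mono) auto
    also have "\<dots> \<le> q (Suc k)" using inc by blast
    finally show ?case .
  qed simp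
  \<comment> \<open>Spectral radius at most 1 bounds the entries of the \<open>k\<close>-th power
    polynomially in \<open>k\<close>, through the Jordan normal form; this contradicts the growth
    like \<open>r ^ k\<close>.\<close>
  have "spectral_radius A \<le> 1"
  proof -
    obtain e where "e \<in> spectrum A" "spectral_radius A = norm e"
      using spectral_radius_mem_max(1)[OF C n] by auto
    then show ?thesis using ev by (simp add: spectrum_def)
  qed
  then obtain c1 c2 d where bd: "\<And>k. norm_bound (A ^\<^sub>m k) (c1 + c2 * of_nat k ^ d)"
    using spectral_radius_jnf_norm_bound_le_1_upper_triangular[OF C] by blast
  have upper: "r ^ k * q 0 \<le> real n * (real n * (c1 + c2 * of_nat k ^ d)\<^sup>2) * q 0" for k
    unfolding q0
    by (rule order.trans[OF growth[of k, unfolded q0]])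
       (simp only: q_def w_pow sq_nrm_mat_vec_le[OF pw v bd])
  have upper': "r ^ k \<le> real n * (real n * (c1 + c2 * of_nat k ^ d)\<^sup>2)" for k
    using upper[of k] q0_pos by simp
  have "(\<lambda>k. real n * (real n * (c1 + c2 * real k ^ d)\<^sup>2) / r ^ k) \<longlonglongrightarrow> 0"
  proof -
    have lim: "(\<lambda>k. real k ^ m / r ^ k) \<longlonglongrightarrow> 0" for m
      using r by real_asymp
    have "(\<lambda>k. real n * real n * (c1\<^sup>2 * (real k ^ 0 / r ^ k) + 2 * c1 * c2 * (real k ^ d / r ^ k)
        + c2\<^sup>2 * (real k ^ (d * 2) / r ^ k))) \<longlonglongrightarrow> real n * real n * (c1\<^sup>2 * 0 + 2 * c1 * c2 * 0 + c2\<^sup>2 * 0)"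
      by (intro tendsto_intros lim)
    moreover have "real n * (real n * (c1 + c2 * real k ^ d)\<^sup>2) / r ^ k
       = real n * real n * (c1\<^sup>2 * (real k ^ 0 / r ^ k) + 2 * c1 * c2 * (real k ^ d / r ^ k)
        + c2\<^sup>2 * (real k ^ (d * 2) / r ^ k))" for k
      unfolding divide_inverse power_mult by (simp add: power2_eq_square algebra_simps)
    ultimately show ?thesis by simp
  qed
  then have "eventually (\<lambda>k. real n * (real n * (c1 + c2 * real k ^ d)\<^sup>2) / r ^ k < 1) sequentially"
    by (rule order_tendstoD) simp
  then obtain k where "real n * (real n * (c1 + c2 * real k ^ d)\<^sup>2) / r ^ k < 1"
    by (auto simp: eventually_sequentially)
  then show False using upper'[of k] r by (simp add: field_simps not_less)
qed

text \<open>The inverse of \<open>M - z\<close>, multiplied by \<open>d\<close>, is Hermitian with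
  eigenvalues \<open>d / (e - z)\<close> of modulus at most 1, hence a contraction. Applying it to
  \<open>(M - z) v\<close> returns \<open>d v\<close>.\<close>

lemma hermitian_shift_lower_bound:
  assumes M: "M \<in> hermitian_mats n" and n: "n > 0" and d: "d > 0"
    and ev: "\<And>e. eigenvalue M e \<Longrightarrow> d \<le> cmod (e - complex_of_real z)"
    and v: "v \<in> carrier_vec n"
  shows "d\<^sup>2 * sq_nrm n (vec_index v) \<le> sq_nrm n (\<lambda>i. (M *\<^sub>v v) $ i - complex_of_real z * v $ i)"
proof -
  have C: "M \<in> carrier_mat n n" using M by (simp add: hermitian_mats_iff)
  define N where "N = char_matrix M (complex_of_real z)"
  have NC: "N \<in> carrier_mat n n" using C by (simp add: N_def)
  have N_index: "N $$ (i, j) = M $$ (i, j) - (if i = j then complex_of_real z else 0)" if "i < n" "j < n" for i j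
    using C that by (simp add: N_def char_matrix_def)
  have NH: "N \<in> hermitian_mats n"
    unfolding hermitian_mats_iff
  proof (intro conjI allI impI NC)
    fix i j assume ij: "i < n" "j < n"
    then have "M $$ (i, j) = cnj (M $$ (j, i))" using M unfolding hermitian_mats_iff by blast
    then show "N $$ (i, j) = cnj (N $$ (j, i))" using ij by (simp add: N_index)
  qed
  have N_vec: "(N *\<^sub>v u) $ i = (M *\<^sub>v u) $ i - complex_of_real z * u $ i"
    if u: "u \<in> carrier_vec n" and i: "i < n" for u i
  proof -
    have "(N *\<^sub>v u) $ i = (\<Sum>j<n. M $$ (i, j) * u $ j - (if i = j then complex_of_real z * u $ j else 0))"
      unfolding mat_vec_index[OF NC u i] by (intro sum.cong) (auto simp: N_index i algebra_simps)
    also have "\<dots> = (M *\<^sub>v u) $ i - complex_of_real z * u $ i"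
      unfolding mat_vec_index[OF C u i] using i by (simp add: sum_subtractf)
    finally show ?thesis .
  qed
  have "\<not> eigenvalue M (complex_of_real z)" using ev[of "complex_of_real z"] d by auto
  then have "det N \<noteq> 0" using eigenvalue_det[OF C] by (simp add: N_def)
  from det_non_zero_imp_unit[OF NC this, of undefined]
  obtain B where BC: "B \<in> carrier_mat n n" and BN: "B * N = 1\<^sub>m n" and NB: "N * B = 1\<^sub>m n"
    by (auto simp: Units_def ring_mat_simps)
  define A where "A = complex_of_real d \<cdot>\<^sub>m B"
  have AC: "A \<in> carrier_mat n n" using BC by (simp add: A_def)
  have A_vec: "A *\<^sub>v u = complex_of_real d \<cdot>\<^sub>v (B *\<^sub>v u)" if "u \<in> carrier_vec n" for u
    using BC that by (intro eq_vecI) (auto simp: A_def)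
  have NA: "N *\<^sub>v (A *\<^sub>v u) = complex_of_real d \<cdot>\<^sub>v u" if u: "u \<in> carrier_vec n" for u
  proof -
    have "N *\<^sub>v (A *\<^sub>v u) = complex_of_real d \<cdot>\<^sub>v (N *\<^sub>v (B *\<^sub>v u))"
      using mult_mat_vec[OF NC] BC u by (simp add: A_vec)
    also have "N *\<^sub>v (B *\<^sub>v u) = u"
      using assoc_mult_mat_vec[OF NC BC u] u by (simp add: NB)
    finally show ?thesis .
  qed
  have AN: "A *\<^sub>v (N *\<^sub>v u) = complex_of_real d \<cdot>\<^sub>v u" if u: "u \<in> carrier_vec n" for u
    using assoc_mult_mat_vec[OF BC NC u] NC u by (simp add: A_vec BN)
  have Av: "A *\<^sub>v u \<in> carrier_vec n" if "u \<in> carrier_vec n" for u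
    using AC that by simp
  have AH: "A \<in> hermitian_mats n"
    unfolding hermitian_mats_iff
  proof (intro conjI allI impI AC)
    \<comment> \<open>Symmetry passes from \<open>N\<close> to its scaled inverse: write
      \<open>d w\<close> as \<open>N (A w)\<close> and move \<open>N\<close> to the other
      side.\<close>
    have *: "vip n (A *\<^sub>v u) w = vip n u (A *\<^sub>v w)" if u: "u \<in> carrier_vec n" and w: "w \<in> carrier_vec n" for u w
    proof -
      have "complex_of_real d * vip n (A *\<^sub>v u) w = vip n (A *\<^sub>v u) (N *\<^sub>v (A *\<^sub>v w))"
        using w by (simp add: NA vip_def sum_distrib_left mult.left_commute)
      also have "\<dots> = vip n (N *\<^sub>v (A *\<^sub>v u)) (A *\<^sub>v w)"
        by (rule vip_hermitian[OF NH Av[OF u] Av[OF w], symmetric])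
      also have "\<dots> = complex_of_real d * vip n u (A *\<^sub>v w)"
        using u by (simp add: NA vip_def sum_distrib_left mult.assoc)
      finally show ?thesis using d by simp
    qed
    fix i j assume ij: "i < n" "j < n"
    \<comment> \<open>The entries are recovered by testing the identity just proved on unit vectors,
      whose images under \<open>A\<close> are the columns of \<open>A\<close>.\<close>
    have col: "(A *\<^sub>v unit_vec n k) $ l = A $$ (l, k)" if "k < n" "l < n" for k l
      using mat_vec_index[OF AC unit_vec_carrier that(2)] that
      by (simp add: unit_vec_def if_distrib cong: if_cong)
    show "A $$ (i, j) = cnj (A $$ (j, i))"
      using *[OF unit_vec_carrier[of n i] unit_vec_carrier[of n j]] ij
      by (simp add: vip_def col) (simp add: unit_vec_def if_distrib if_distribR cong: if_cong)
  qed
  have "cmod e \<le> 1" if "eigenvalue A e" for e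
  proof -
    from that obtain u where u: "u \<in> carrier_vec n" and u0: "u \<noteq> 0\<^sub>v n" and Au: "A *\<^sub>v u = e \<cdot>\<^sub>v u"
      using AC by (auto simp: eigenvalue_def eigenvector_def)
    have eq: "complex_of_real d \<cdot>\<^sub>v u = e \<cdot>\<^sub>v (N *\<^sub>v u)"
      using NA[OF u] mult_mat_vec[OF NC u] by (simp add: Au)
    have eqi: "complex_of_real d * u $ i = e * (N *\<^sub>v u) $ i" if "i < n" for i
      using arg_cong[OF eq, of "\<lambda>w. w $ i"] u NC that by simp
    have e0: "e \<noteq> 0"
    proof
      assume "e = 0"
      then have "u = 0\<^sub>v n" using eqi d u by (intro eq_vecI) auto
      with u0 show False by simp
    qed
    \<comment> \<open>From \<open>d u = e (M - z) u\<close>, the vector \<open>u\<close> is an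
      eigenvector of \<open>M\<close> for \<open>d / e + z\<close>, whose distance to
      \<open>z\<close> is \<open>d / cmod e\<close>.\<close>
    have "M *\<^sub>v u = (complex_of_real d / e + complex_of_real z) \<cdot>\<^sub>v u"
    proof (rule eq_vecI)
      fix i assume "i < dim_vec ((complex_of_real d / e + complex_of_real z) \<cdot>\<^sub>v u)"
      then have i: "i < n" using u by simp
      show "(M *\<^sub>v u) $ i = ((complex_of_real d / e + complex_of_real z) \<cdot>\<^sub>v u) $ i"
        using eqi[OF i] N_vec[OF u i] e0 u i by (simp add: field_simps)
    qed (use C u in simp)
    then have "eigenvalue M (complex_of_real d / e + complex_of_real z)"
      using C u u0 by (auto simp: eigenvalue_def eigenvector_def)
    from ev[OF this] have "d \<le> d / cmod e" using d by (simp add: norm_divide)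
    then show ?thesis using d e0 by (simp add: field_simps)
  qed
  then have "sq_nrm n (vec_index (A *\<^sub>v (N *\<^sub>v v))) \<le> sq_nrm n (vec_index (N *\<^sub>v v))"
    using NC v by (intro hermitian_contraction[OF AH _ n]) auto
  also have "sq_nrm n (vec_index (A *\<^sub>v (N *\<^sub>v v))) = d\<^sup>2 * sq_nrm n (vec_index v)"
    using v d by (simp add: AN sq_nrm_def norm_mult power_mult_distrib sum_distrib_left)
  also have "sq_nrm n (vec_index (N *\<^sub>v v)) = sq_nrm n (\<lambda>i. (M *\<^sub>v v) $ i - complex_of_real z * v $ i)"
    using v by (simp add: sq_nrm_def N_vec)
  finally show ?thesis .
qed

section \<open>Exponential moments of the GUE\<close>

text \<open>Two independent arguments make the form real-linear in each of them, as rounding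
  requires, and let the first one be aligned with \<open>A v\<close>.\<close>

definition herm_form :: "nat \<Rightarrow> complex mat \<Rightarrow> (nat \<Rightarrow> complex) \<Rightarrow> (nat \<Rightarrow> complex) \<Rightarrow> real" where
  "herm_form n A u v = Re (\<Sum>i<n. \<Sum>j<n. cnj (u i) * A $$ (i, j) * v j)"

lemma measurable_hermitian_entry:
  assumes "i < n" "j < n"
  shows "(\<lambda>A. A $$ (i, j)) \<in> borel_measurable (hermitian_borel n)"
proof -
  have "mat_entries n \<in> hermitian_borel n \<rightarrow>\<^sub>M Pi\<^sub>M ({..<n} \<times> {..<n}) (\<lambda>_. borel)"
    unfolding hermitian_borel_def
    by (rule measurable_vimage_algebra1) (auto simp: mat_entries_def space_PiM)
  from measurable_compose[OF this measurable_component_singleton[of "(i, j)"]] assms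
  have "(\<lambda>A. mat_entries n A (i, j)) \<in> borel_measurable (hermitian_borel n)" by simp
  then show ?thesis using assms by (simp add: mat_entries_def)
qed

lemma measurable_herm_form [measurable]:
  "(\<lambda>A. herm_form n A u v) \<in> borel_measurable (hermitian_borel n)"
  unfolding herm_form_def
  by (rule measurable_compose[OF _ borel_measurable_continuous_onI[OF continuous_on_Re[OF continuous_on_id]]])
     (intro borel_measurable_sum borel_measurable_times borel_measurable_const measurable_hermitian_entry, auto)

lemma borel_measurable_herm_form_lebesgue [measurable]:
  "(\<lambda>A. herm_form n A u v) \<in> borel_measurable (hermitian_lebesgue n)"
  using measurable_herm_form by (simp add: hermitian_lebesgue_def)

text \<open>Completing the square: the exponent has its vertex at \<open>c / (2 * k)\<close>. The
  Gaussian integral stays unevaluated because the same integral occurs in the normalisation of the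
  density, where it cancels.\<close>

lemma nn_integral_gaussian_shift:
  fixes c k :: real
  assumes k: "k > 0"
  shows "(\<integral>\<^sup>+y. ennreal (exp (c * y - k * y\<^sup>2)) \<partial>lborel) =
    ennreal (exp (c\<^sup>2 / (4 * k))) * (\<integral>\<^sup>+y. ennreal (exp (- k * y\<^sup>2)) \<partial>lborel)"
proof -
  have sq: "c * (c / (2 * k) + y) - k * (c / (2 * k) + y)\<^sup>2 = c\<^sup>2 / (4 * k) + - k * y\<^sup>2" for y
    using k by (simp add: field_simps power2_eq_square)
  have "(\<integral>\<^sup>+y. ennreal (exp (c * y - k * y\<^sup>2)) \<partial>lborel)
      = (\<integral>\<^sup>+y. ennreal (exp (c * (c / (2 * k) + y) - k * (c / (2 * k) + y)\<^sup>2)) \<partial>lborel)"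
    by (subst nn_integral_real_affine[where c = 1 and t = "c / (2 * k)"]) auto
  also have "\<dots> = (\<integral>\<^sup>+y. ennreal (exp (c\<^sup>2 / (4 * k))) * ennreal (exp (- k * y\<^sup>2)) \<partial>lborel)"
    by (simp only: sq exp_add ennreal_mult'[OF exp_ge_zero])
  also have "\<dots> = ennreal (exp (c\<^sup>2 / (4 * k))) * (\<integral>\<^sup>+y. ennreal (exp (- k * y\<^sup>2)) \<partial>lborel)"
    by (rule nn_integral_cmult) measurable
  finally show ?thesis .
qed

section \<open>The bilinear form and the trace in real coordinates\<close>

lemma sum_square_swap:
  "(\<Sum>p\<in>A \<times> A. f (prod.swap p)) = (\<Sum>p\<in>A \<times> A. f p)"
  by (rule sum.reindex_bij_witness[of _ prod.swap prod.swap]) auto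

text \<open>Coefficients of \<open>x (i, j)\<close> and of \<open>x (j, i)\<close> in the real part of \<open>b (i, j)\<close> times the
  \<open>(i, j)\<close> entry of the matrix with coordinates \<open>x\<close>.\<close>

definition coord_P :: "(nat \<times> nat \<Rightarrow> complex) \<Rightarrow> nat \<times> nat \<Rightarrow> real" where
  "coord_P b p = (if fst p \<le> snd p then Re (b p) else Im (b p))"

definition coord_Q :: "(nat \<times> nat \<Rightarrow> complex) \<Rightarrow> nat \<times> nat \<Rightarrow> real" where
  "coord_Q b p = (if fst p = snd p then 0 else if fst p < snd p then - Im (b p) else Re (b p))"

text \<open>Off the diagonal, the coordinate \<open>x p\<close> occurs in two conjugate entries, at
  \<open>p\<close> and at its transpose. The second contribution is \<open>coord_Q\<close> at the
  swapped index, which is 0 on the diagonal.\<close>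

definition coord_coeff :: "(nat \<times> nat \<Rightarrow> complex) \<Rightarrow> nat \<times> nat \<Rightarrow> real" where
  "coord_coeff b p = coord_P b p + coord_Q b (prod.swap p)"

text \<open>In the trace of the square a diagonal coordinate is squared once, while two conjugate
  entries count each off-diagonal coordinate twice.\<close>

definition trace_weight :: "nat \<times> nat \<Rightarrow> real" where
  "trace_weight p = (if fst p = snd p then 1 else 2)"

lemma herm_form_coords:
  "herm_form n (herm_of_coords n x) u v
     = (\<Sum>p\<in>{..<n} \<times> {..<n}. coord_coeff (\<lambda>(i, j). cnj (u i) * v j) p * x p)"
proof -
  define b where "b = (\<lambda>(i, j). cnj (u i) * v j)"
  have "herm_form n (herm_of_coords n x) u v
      = (\<Sum>i<n. \<Sum>j<n. Re (cnj (u i) * herm_of_coords n x $$ (i, j) * v j))"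
    by (simp add: herm_form_def)
  also have "\<dots> = (\<Sum>i<n. \<Sum>j<n. coord_P b (i, j) * x (i, j) + coord_Q b (i, j) * x (prod.swap (i, j)))"
    by (intro sum.cong refl)
       (auto simp: b_def herm_of_coords_def coord_P_def coord_Q_def algebra_simps)
  also have "\<dots> = (\<Sum>p\<in>{..<n} \<times> {..<n}. coord_P b p * x p + coord_Q b p * x (prod.swap p))"
    unfolding sum.cartesian_product by (intro sum.cong refl) auto
  also have "\<dots> = (\<Sum>p\<in>{..<n} \<times> {..<n}. coord_P b p * x p)
      + (\<Sum>p\<in>{..<n} \<times> {..<n}. coord_Q b (prod.swap p) * x p)"
    by (subst sum_square_swap[symmetric, of "\<lambda>p. coord_Q b (prod.swap p) * x p"]) (simp add: sum.distrib)
  also have "\<dots> = (\<Sum>p\<in>{..<n} \<times> {..<n}. coord_coeff b p * x p)"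
    by (simp add: coord_coeff_def algebra_simps sum.distrib)
  finally show ?thesis by (simp add: b_def)
qed

lemma trace_square_coords:
  "Re (mat_trace (herm_of_coords n x * herm_of_coords n x))
     = (\<Sum>p\<in>{..<n} \<times> {..<n}. trace_weight p * (x p)\<^sup>2)"
proof -
  let ?A = "herm_of_coords n x"
  define q :: "nat \<times> nat \<Rightarrow> real" where "q p = (if fst p = snd p then 0 else 1)" for p
  have C: "?A \<in> carrier_mat n n" by (simp add: herm_of_coords_def)
  have "mat_trace (?A * ?A) = (\<Sum>i<n. \<Sum>j<n. ?A $$ (i, j) * ?A $$ (j, i))"
    using C by (auto simp: mat_trace_def scalar_prod_def atLeast0LessThan intro!: sum.cong)
  then have "Re (mat_trace (?A * ?A)) = (\<Sum>i<n. \<Sum>j<n. Re (?A $$ (i, j) * ?A $$ (j, i)))"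
    by simp
  also have "\<dots> = (\<Sum>i<n. \<Sum>j<n. (x (i, j))\<^sup>2 + q (i, j) * (x (prod.swap (i, j)))\<^sup>2)"
    by (intro sum.cong refl)
       (auto simp: herm_of_coords_def q_def power2_eq_square)
  also have "\<dots> = (\<Sum>p\<in>{..<n} \<times> {..<n}. (x p)\<^sup>2 + q p * (x (prod.swap p))\<^sup>2)"
    unfolding sum.cartesian_product by (intro sum.cong refl) auto
  also have "\<dots> = (\<Sum>p\<in>{..<n} \<times> {..<n}. (x p)\<^sup>2) + (\<Sum>p\<in>{..<n} \<times> {..<n}. q (prod.swap p) * (x p)\<^sup>2)"
    by (subst sum_square_swap[symmetric, of "\<lambda>p. q (prod.swap p) * (x p)\<^sup>2"]) (simp add: sum.distrib)
  also have "\<dots> = (\<Sum>p\<in>{..<n} \<times> {..<n}. trace_weight p * (x p)\<^sup>2)"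
    unfolding sum.distrib[symmetric]
    by (intro sum.cong refl) (auto simp: q_def trace_weight_def)
  finally show ?thesis .
qed

text \<open>Off the diagonal two contributions add up, and the factor 2 in
  \<open>(a + c)^2 <= 2 (a^2 + c^2)\<close> is exactly compensated by the weight. What remains at
  \<open>p\<close> is bounded by the squares of the real and the imaginary part of
  \<open>b p\<close>.\<close>

lemma sum_coord_coeff_le:
  "(\<Sum>p\<in>{..<n} \<times> {..<n}. (coord_coeff b p)\<^sup>2 / trace_weight p) \<le> (\<Sum>p\<in>{..<n} \<times> {..<n}. (cmod (b p))\<^sup>2)"
proof -
  have "(coord_coeff b p)\<^sup>2 / trace_weight p \<le> (coord_P b p)\<^sup>2 + (coord_Q b (prod.swap p))\<^sup>2" for p
  proof (cases "fst p = snd p")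
    case False
    have "(a + c)\<^sup>2 / 2 \<le> a\<^sup>2 + c\<^sup>2" for a c :: real
      using zero_le_power2[of "a - c"] by (simp add: power2_sum power2_diff)
    then show ?thesis using False by (simp add: coord_coeff_def trace_weight_def)
  qed (simp add: coord_coeff_def coord_Q_def trace_weight_def)
  then have "(\<Sum>p\<in>{..<n} \<times> {..<n}. (coord_coeff b p)\<^sup>2 / trace_weight p)
      \<le> (\<Sum>p\<in>{..<n} \<times> {..<n}. (coord_P b p)\<^sup>2) + (\<Sum>p\<in>{..<n} \<times> {..<n}. (coord_Q b (prod.swap p))\<^sup>2)"
    unfolding sum.distrib[symmetric] by (intro sum_mono) blast
  also have "\<dots> = (\<Sum>p\<in>{..<n} \<times> {..<n}. (coord_P b p)\<^sup>2 + (coord_Q b p)\<^sup>2)"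
    by (simp add: sum_square_swap[of "\<lambda>p. (coord_Q b p)\<^sup>2"] sum.distrib)
  also have "\<dots> \<le> (\<Sum>p\<in>{..<n} \<times> {..<n}. (cmod (b p))\<^sup>2)"
    by (intro sum_mono) (auto simp: coord_P_def coord_Q_def cmod_power2)
  finally show ?thesis .
qed

text \<open>In real coordinates the density times the exponential is a product of functions of one
  variable, so the integral factorises and each factor is handled by completing the square.\<close>

lemma GUE_exp_moment:
  assumes GUE: "is_GUE n \<Omega> H" and n: "n \<ge> 1"
  shows "(\<integral>\<^sup>+\<omega>. ennreal (exp (herm_form n (H \<omega>) u v)) \<partial>\<Omega>)
    \<le> ennreal (exp (sq_nrm n u * sq_nrm n v / (2 * real n)))"
proof -
  define I where "I = {..<n} \<times> {..<n}"
  have [simp]: "finite I" by (simp add: I_def)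
  define k where "k p = real n / 2 * trace_weight p" for p
  have k_pos: "k p > 0" for p using n by (simp add: k_def trace_weight_def)
  define cf :: "(nat \<Rightarrow> complex) \<Rightarrow> (nat \<Rightarrow> complex) \<Rightarrow> nat \<times> nat \<Rightarrow> real"
    where "cf u v = coord_coeff (\<lambda>(i, j). cnj (u i) * v j)" for u v
  define J where "J p = (\<integral>\<^sup>+y. ennreal (exp (- k p * y\<^sup>2)) \<partial>lborel)" for p
  interpret prob_space \<Omega> using GUE by (simp add: is_GUE_def)
  interpret product_sigma_finite "\<lambda>_::nat \<times> nat. lborel :: real measure" ..
  obtain c where c: "c > 0" and D: "distributed \<Omega> (hermitian_lebesgue n) H
        (\<lambda>A. ennreal (c * exp (- (real n / 2) * Re (mat_trace (A * A)))))"
    using GUE by (auto simp: is_GUE_def)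
  let ?f = "\<lambda>A. ennreal (c * exp (- (real n / 2) * Re (mat_trace (A * A))))"
  have [measurable]: "?f \<in> borel_measurable (hermitian_lebesgue n)"
    using D by (rule distributed_borel_measurable)
  have moment: "(\<integral>\<^sup>+\<omega>. ennreal (exp (herm_form n (H \<omega>) u v)) \<partial>\<Omega>)
      = ennreal (exp (\<Sum>p\<in>I. (cf u v p)\<^sup>2 / (4 * k p))) * (ennreal c * (\<Prod>p\<in>I. J p))" for u v
  proof -
    have "(\<integral>\<^sup>+\<omega>. ennreal (exp (herm_form n (H \<omega>) u v)) \<partial>\<Omega>)
        = (\<integral>\<^sup>+A. ?f A * ennreal (exp (herm_form n A u v)) \<partial>hermitian_lebesgue n)"
      by (rule distributed_nn_integral[OF D, symmetric]) measurable
    also have "\<dots> = (\<integral>\<^sup>+x. ?f (herm_of_coords n x) * ennreal (exp (herm_form n (herm_of_coords n x) u v))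
        \<partial>Pi\<^sub>M I (\<lambda>_. lborel))"
      unfolding hermitian_lebesgue_def I_def
      by (rule nn_integral_distr[OF measurable_herm_of_coords])
         (unfold hermitian_lebesgue_def[symmetric], measurable)
    also have "\<dots> = (\<integral>\<^sup>+x. ennreal c * (\<Prod>p\<in>I. ennreal (exp (cf u v p * x p - k p * (x p)\<^sup>2))) \<partial>Pi\<^sub>M I (\<lambda>_. lborel))"
    proof (rule nn_integral_cong)
      fix x :: "nat \<times> nat \<Rightarrow> real"
      have "- (real n / 2) * Re (mat_trace (herm_of_coords n x * herm_of_coords n x))
          + herm_form n (herm_of_coords n x) u v = (\<Sum>p\<in>I. cf u v p * x p - k p * (x p)\<^sup>2)"
        unfolding trace_square_coords herm_form_coords I_def[symmetric] cf_def[symmetric]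
        by (simp add: sum_distrib_left sum_subtractf sum_negf k_def mult.assoc)
      then have e: "exp (- (real n / 2) * Re (mat_trace (herm_of_coords n x * herm_of_coords n x)))
          * exp (herm_form n (herm_of_coords n x) u v) = (\<Prod>p\<in>I. exp (cf u v p * x p - k p * (x p)\<^sup>2))"
        unfolding exp_add[symmetric] by (simp only: exp_sum[OF \<open>finite I\<close>])
      have "?f (herm_of_coords n x) * ennreal (exp (herm_form n (herm_of_coords n x) u v))
          = ennreal (c * (\<Prod>p\<in>I. exp (cf u v p * x p - k p * (x p)\<^sup>2)))"
        unfolding e[symmetric] using c by (simp add: ennreal_mult'[symmetric] mult.assoc)
      then show "?f (herm_of_coords n x) * ennreal (exp (herm_form n (herm_of_coords n x) u v))
          = ennreal c * (\<Prod>p\<in>I. ennreal (exp (cf u v p * x p - k p * (x p)\<^sup>2)))"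
        using c by (simp add: ennreal_mult' prod_ennreal)
    qed
    also have "\<dots> = ennreal c * (\<integral>\<^sup>+x. (\<Prod>p\<in>I. ennreal (exp (cf u v p * x p - k p * (x p)\<^sup>2))) \<partial>Pi\<^sub>M I (\<lambda>_. lborel))"
      by (rule nn_integral_cmult) measurable
    also have "\<dots> = ennreal c * (\<Prod>p\<in>I. \<integral>\<^sup>+y. ennreal (exp (cf u v p * y - k p * y\<^sup>2)) \<partial>lborel)"
      by (subst product_nn_integral_prod) simp_all
    also have "\<dots> = ennreal c * (\<Prod>p\<in>I. ennreal (exp ((cf u v p)\<^sup>2 / (4 * k p))) * J p)"
      unfolding J_def by (simp only: nn_integral_gaussian_shift[OF k_pos])
    also have "\<dots> = ennreal (exp (\<Sum>p\<in>I. (cf u v p)\<^sup>2 / (4 * k p))) * (ennreal c * (\<Prod>p\<in>I. J p))"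
      by (simp add: prod.distrib prod_ennreal exp_sum mult.left_commute)
    finally show ?thesis .
  qed
  \<comment> \<open>For zero vectors the moment is the total mass 1, which identifies the product of
    \<open>c\<close> with the Gaussian integrals.\<close>
  have "ennreal c * (\<Prod>p\<in>I. J p) = 1"
    using moment[of "\<lambda>_. 0" "\<lambda>_. 0"]
    by (simp add: herm_form_def cf_def coord_coeff_def coord_P_def coord_Q_def emeasure_space_1 case_prod_unfold)
  then have "(\<integral>\<^sup>+\<omega>. ennreal (exp (herm_form n (H \<omega>) u v)) \<partial>\<Omega>)
      = ennreal (exp (\<Sum>p\<in>I. (cf u v p)\<^sup>2 / (4 * k p)))"
    using moment[of u v] by simp
  also have "(\<Sum>p\<in>I. (cf u v p)\<^sup>2 / (4 * k p)) = (\<Sum>p\<in>I. (cf u v p)\<^sup>2 / trace_weight p) / (2 * real n)"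
    unfolding sum_divide_distrib by (intro sum.cong refl) (simp add: k_def field_simps)
  also have "\<dots> \<le> (\<Sum>p\<in>I. (cmod ((\<lambda>(i, j). cnj (u i) * v j) p))\<^sup>2) / (2 * real n)"
    unfolding cf_def I_def by (intro divide_right_mono sum_coord_coeff_le) simp
  also have "(\<Sum>p\<in>I. (cmod ((\<lambda>(i, j). cnj (u i) * v j) p))\<^sup>2) = sq_nrm n u * sq_nrm n v"
    unfolding I_def sq_nrm_def sum_product sum.cartesian_product
    by (intro sum.cong refl) (auto simp: norm_mult power_mult_distrib)
  finally show ?thesis by (simp add: ennreal_leI)
qed

section \<open>The operator norm of a GUE matrix\<close>

definition gauss_int :: "int \<times> int \<Rightarrow> complex" where
  "gauss_int p = Complex (of_int (fst p)) (of_int (snd p))"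

lemma real_rounding: "\<exists>p::int. \<bar>of_int p - a\<bar> \<le> 1 \<and> a * w \<le> of_int p * (w::real)"
proof (cases "w \<ge> 0")
  case True
  then show ?thesis
    by (intro exI[of _ "\<lceil>a\<rceil>"] conjI mult_right_mono) linarith+
next
  case False
  then show ?thesis
    by (intro exI[of _ "\<lfloor>a\<rfloor>"] conjI mult_right_mono_neg) linarith+
qed

lemma complex_rounding:
  "\<exists>p. (cmod (gauss_int p))\<^sup>2 \<le> 2 * (cmod u)\<^sup>2 + 4 \<and> Re (cnj u * w) \<le> Re (cnj (gauss_int p) * w)"
proof -
  obtain p q :: int where p: "\<bar>of_int p - Re u\<bar> \<le> 1" "Re u * Re w \<le> of_int p * Re w"
    and q: "\<bar>of_int q - Im u\<bar> \<le> 1" "Im u * Im w \<le> of_int q * Im w"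
    using real_rounding by metis
  \<comment> \<open>Used for the real and for the imaginary part, the additive 2 becomes the 4 of
    the claim.\<close>
  have *: "a\<^sup>2 \<le> 2 * b\<^sup>2 + 2" if "\<bar>a - b\<bar> \<le> 1" for a b :: real
  proof -
    have "(a - b)\<^sup>2 \<le> 1" using that by (simp add: abs_square_le_1)
    moreover have "a\<^sup>2 \<le> 2 * b\<^sup>2 + 2 * (a - b)\<^sup>2"
      using zero_le_power2[of "a - 2 * b"] by (simp add: power2_eq_square algebra_simps)
    ultimately show ?thesis by linarith
  qed
  show ?thesis
    using p(2) q(2) *[OF p(1)] *[OF q(1)]
    by (intro exI[of _ "(p, q)"]) (simp add: gauss_int_def cmod_power2)
qed

text \<open>The radius is what rounding makes of squared length at most \<open>n\<close>:
  \<open>2 * n\<close> from the doubled norm and 4 for each coordinate. Extensionality fixes the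
  values outside \<open>{..<n}\<close>, so that the set can be finite.\<close>

definition gauss_net :: "nat \<Rightarrow> (nat \<Rightarrow> int \<times> int) set" where
  "gauss_net n = {m \<in> {..<n} \<rightarrow>\<^sub>E UNIV. sq_nrm n (\<lambda>i. gauss_int (m i)) \<le> 6 * real n}"

lemma gauss_net_rounding:
  assumes u: "sq_nrm n u \<le> real n"
  shows "\<exists>m\<in>gauss_net n. Re (\<Sum>i<n. cnj (u i) * w i) \<le> Re (\<Sum>i<n. cnj (gauss_int (m i)) * w i)"
proof -
  have "\<forall>i. \<exists>p. (cmod (gauss_int p))\<^sup>2 \<le> 2 * (cmod (u i))\<^sup>2 + 4
      \<and> Re (cnj (u i) * w i) \<le> Re (cnj (gauss_int p) * w i)"
    using complex_rounding by blast
  then obtain p where p: "\<And>i. (cmod (gauss_int (p i)))\<^sup>2 \<le> 2 * (cmod (u i))\<^sup>2 + 4"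
      "\<And>i. Re (cnj (u i) * w i) \<le> Re (cnj (gauss_int (p i)) * w i)"
    unfolding choice_iff by blast
  define m where "m = restrict p {..<n}"
  have "sq_nrm n (\<lambda>i. gauss_int (m i)) \<le> (\<Sum>i<n. 2 * (cmod (u i))\<^sup>2 + 4)"
    unfolding sq_nrm_def m_def using p(1) by (intro sum_mono) simp
  also have "\<dots> = 2 * sq_nrm n u + 4 * real n"
    by (simp add: sum.distrib sum_distrib_left sq_nrm_def)
  finally have "m \<in> gauss_net n"
    using u by (simp add: gauss_net_def m_def)
  moreover have "Re (\<Sum>i<n. cnj (u i) * w i) \<le> Re (\<Sum>i<n. cnj (gauss_int (m i)) * w i)"
    unfolding Re_sum m_def using p(2) by (intro sum_mono) (simp del: times_complex.sel)
  ultimately show ?thesis by blast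
qed

text \<open>The form is real-linear in each argument, so \<open>u\<close> is rounded first with
  \<open>v\<close> fixed, and then \<open>v\<close> with the rounded \<open>u\<close> fixed. Each
  rounding looks only at the length of the vector being rounded, so the bounds do not
  compound.\<close>

lemma herm_form_le_net:
  assumes u: "sq_nrm n u \<le> real n" and v: "sq_nrm n v \<le> real n"
  shows "\<exists>p\<in>gauss_net n. \<exists>q\<in>gauss_net n.
    herm_form n A u v \<le> herm_form n A (\<lambda>i. gauss_int (p i)) (\<lambda>i. gauss_int (q i))"
proof -
  have left: "herm_form n A u v = Re (\<Sum>i<n. cnj (u i) * (\<Sum>j<n. A $$ (i, j) * v j))" for u v
    unfolding herm_form_def by (simp only: sum_distrib_left mult.assoc)
  \<comment> \<open>Conjugation leaves the real part unchanged and brings the form into the shape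
    with \<open>cnj\<close> on the vector to be rounded.\<close>
  have right: "herm_form n A u v = Re (\<Sum>j<n. cnj (v j) * cnj (\<Sum>i<n. cnj (u i) * A $$ (i, j)))" for u v
  proof -
    have "(\<Sum>i<n. \<Sum>j<n. cnj (u i) * A $$ (i, j) * v j) = (\<Sum>j<n. v j * (\<Sum>i<n. cnj (u i) * A $$ (i, j)))"
      by (subst sum.swap) (simp add: sum_distrib_left mult.commute mult.left_commute)
    then have "herm_form n A u v = Re (cnj (\<Sum>j<n. v j * (\<Sum>i<n. cnj (u i) * A $$ (i, j))))"
      unfolding herm_form_def by (simp only: cnj.sel)
    then show ?thesis by (simp only: cnj_sum complex_cnj_mult)
  qed
  obtain p where p: "p \<in> gauss_net n" "herm_form n A u v \<le> herm_form n A (\<lambda>i. gauss_int (p i)) v"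
    using gauss_net_rounding[OF u, of "\<lambda>i. \<Sum>j<n. A $$ (i, j) * v j"] unfolding left[symmetric] by blast
  obtain q where q: "q \<in> gauss_net n"
    "herm_form n A (\<lambda>i. gauss_int (p i)) v \<le> herm_form n A (\<lambda>i. gauss_int (p i)) (\<lambda>i. gauss_int (q i))"
    using gauss_net_rounding[OF v, of "\<lambda>j. cnj (\<Sum>i<n. cnj (gauss_int (p i)) * A $$ (i, j))"]
    unfolding right[symmetric] by blast
  show ?thesis using p(1) q(1) order.trans[OF p(2) q(2)] by blast
qed

section \<open>Exponential bound on the size of the net\<close>

lemma sum_half_power_int_le: "(\<Sum>j=-int N..int N. (1/2::real) ^ nat \<bar>j\<bar>) \<le> 4"
proof -
  have geo: "(\<Sum>j\<le>N. (1/2::real) ^ j) \<le> 2"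
    using sum_gp_basic[of "1/2::real" N] by (simp add: atMost_atLeast0)
  \<comment> \<open>The two half-lines share the point 0; counting it twice yields 2 + 2 as the
    bound.\<close>
  have "{-int N..int N} \<subseteq> (\<lambda>j. int j) ` {..N} \<union> (\<lambda>j. - int j) ` {..N}"
  proof
    fix j assume "j \<in> {-int N..int N}"
    then show "j \<in> (\<lambda>j. int j) ` {..N} \<union> (\<lambda>j. - int j) ` {..N}"
      by (cases "j \<ge> 0") (auto simp: image_iff intro: bexI[of _ "nat \<bar>j\<bar>"])
  qed
  then have "(\<Sum>j=-int N..int N. (1/2::real) ^ nat \<bar>j\<bar>)
      \<le> (\<Sum>j\<in>(\<lambda>j. int j) ` {..N} \<union> (\<lambda>j. - int j) ` {..N}. (1/2::real) ^ nat \<bar>j\<bar>)"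
    by (intro sum_mono2) auto
  also have "\<dots> \<le> (\<Sum>j\<in>(\<lambda>j. int j) ` {..N}. (1/2::real) ^ nat \<bar>j\<bar>) + (\<Sum>j\<in>(\<lambda>j. - int j) ` {..N}. (1/2::real) ^ nat \<bar>j\<bar>)"
    by (subst sum.union_inter[symmetric]) (auto intro!: sum_nonneg)
  also have "\<dots> = (\<Sum>j\<le>N. (1/2::real) ^ j) + (\<Sum>j\<le>N. (1/2::real) ^ j)"
    by (simp add: sum.reindex inj_on_def)
  finally show ?thesis using geo by linarith
qed

text \<open>The weight \<open>2 ^ (6 n - sum of |coordinates|)\<close> is at least 1 on the net and factorises over
  the coordinates, which bounds the cardinality exponentially.\<close>

lemma gauss_net_card: "finite (gauss_net n)" "real (card (gauss_net n)) \<le> 1024 ^ n"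
proof -
  define R where "R = {-int (6 * n)..int (6 * n)}"
  define l :: "int \<times> int \<Rightarrow> nat" where "l p = nat \<bar>fst p\<bar> + nat \<bar>snd p\<bar>" for p
  \<comment> \<open>Integers satisfy \<open>|a| <= a^2\<close>, so the squared length controls the
    sum of the absolute values of all coordinates, here by \<open>6 * n\<close>.\<close>
  have l_le: "real (l p) \<le> (cmod (gauss_int p))\<^sup>2" for p
  proof -
    have "real (nat \<bar>a\<bar>) \<le> (of_int a)\<^sup>2" for a :: int
    proof -
      have "int (nat \<bar>a\<bar>) \<le> a\<^sup>2"
        using mult_left_mono[of 1 "\<bar>a\<bar>" "\<bar>a\<bar>"] by (cases "a = 0") (auto simp: power2_eq_square abs_mult[symmetric])
      then show ?thesis by (metis of_int_of_nat_eq of_int_le_iff of_int_power)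
    qed
    then show ?thesis by (simp add: l_def gauss_int_def cmod_power2 add_mono)
  qed
  have sum_l: "(\<Sum>i<n. l (m i)) \<le> 6 * n" if "m \<in> gauss_net n" for m
  proof -
    have "real (\<Sum>i<n. l (m i)) \<le> sq_nrm n (\<lambda>i. gauss_int (m i))"
      unfolding sq_nrm_def of_nat_sum by (intro sum_mono l_le)
    also have "\<dots> \<le> real (6 * n)" using that by (simp add: gauss_net_def)
    finally show ?thesis by (simp only: of_nat_le_iff)
  qed
  have sub: "gauss_net n \<subseteq> {..<n} \<rightarrow>\<^sub>E (R \<times> R)"
  proof
    fix m assume m: "m \<in> gauss_net n"
    have "l (m i) \<le> 6 * n" if "i < n" for i
      using sum_l[OF m] member_le_sum[of i "{..<n}" "\<lambda>i. l (m i)"] that by simp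
    then have "m i \<in> R \<times> R" if "i < n" for i
      using that by (fastforce simp: l_def R_def mem_Times_iff)
    then show "m \<in> {..<n} \<rightarrow>\<^sub>E (R \<times> R)"
      using m by (auto simp: gauss_net_def PiE_iff)
  qed
  have fin: "finite ({..<n} \<rightarrow>\<^sub>E (R \<times> R))" by (intro finite_PiE) (auto simp: R_def)
  then show "finite (gauss_net n)" using sub by (rule rev_finite_subset)
  have "real (card (gauss_net n)) = (\<Sum>m\<in>gauss_net n. 1)" by simp
  also have "\<dots> \<le> (\<Sum>m\<in>gauss_net n. 2 ^ (6 * n) * (\<Prod>i<n. (1/2::real) ^ l (m i)))"
  proof (rule sum_mono)
    fix m assume m: "m \<in> gauss_net n"
    have "(1::real) \<le> 2 ^ (6 * n - (\<Sum>i<n. l (m i)))" by simp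
    also have "\<dots> = 2 ^ (6 * n) * (\<Prod>i<n. (1/2::real) ^ l (m i))"
      using sum_l[OF m] by (simp add: power_diff power_sum power_one_over prod_dividef)
    finally show "1 \<le> 2 ^ (6 * n) * (\<Prod>i<n. (1/2::real) ^ l (m i))" .
  qed
  also have "\<dots> \<le> (\<Sum>m\<in>{..<n} \<rightarrow>\<^sub>E (R \<times> R). 2 ^ (6 * n) * (\<Prod>i<n. (1/2::real) ^ l (m i)))"
    using fin sub by (intro sum_mono2 mult_nonneg_nonneg prod_nonneg) auto
  also have "\<dots> = 2 ^ (6 * n) * (\<Prod>i<n. \<Sum>p\<in>R \<times> R. (1/2::real) ^ l p)"
    unfolding sum_distrib_left[symmetric] by (subst prod_sum_PiE) (auto simp: R_def)
  also have "(\<Sum>p\<in>R \<times> R. (1/2::real) ^ l p) = (\<Sum>j\<in>R. (1/2::real) ^ nat \<bar>j\<bar>) * (\<Sum>j\<in>R. (1/2::real) ^ nat \<bar>j\<bar>)"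
    unfolding sum_product sum.cartesian_product by (intro sum.cong) (auto simp: l_def power_add)
  also have "2 ^ (6 * n) * (\<Prod>i<n. (\<Sum>j\<in>R. (1/2::real) ^ nat \<bar>j\<bar>) * (\<Sum>j\<in>R. (1/2::real) ^ nat \<bar>j\<bar>))
      \<le> 2 ^ (6 * n) * (\<Prod>i<n. 4 * 4)"
    using sum_half_power_int_le[of "6 * n"] unfolding R_def
    by (intro mult_left_mono prod_mono conjI mult_mono mult_nonneg_nonneg sum_nonneg) auto
  \<comment> \<open>\<open>2 ^ 6 * 16 = 1024\<close>, with a factor 4 for each of the two integers
    in a coordinate.\<close>
  also have "\<dots> = 1024 ^ n" by (simp add: power_mult power_mult_distrib[symmetric])
  finally show "real (card (gauss_net n)) \<le> 1024 ^ n" .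
qed

text \<open>A finite substitute for the operator norm being at least 40: vectors are scaled to
  length \<open>sqrt (real n)\<close>, whence the factor \<open>n\<close>, and the restriction to
  the net makes the event a finite union.\<close>

definition large_form :: "nat \<Rightarrow> complex mat \<Rightarrow> bool" where
  "large_form n A \<longleftrightarrow> (\<exists>p\<in>gauss_net n. \<exists>q\<in>gauss_net n.
     40 * real n \<le> herm_form n A (\<lambda>i. gauss_int (p i)) (\<lambda>i. gauss_int (q i)))"

text \<open>Chernoff's bound with parameter 1 for each pair: the exponential moment is at most
  \<open>exp (18 * real n)\<close>, against the threshold \<open>40 * real n\<close>. The remaining
  \<open>exp (- 22 * real n)\<close> outweighs the number of pairs, at most
  \<open>2 ^ (20 * n)\<close>.\<close>

lemma GUE_large_form:
  assumes GUE: "is_GUE n \<Omega> H" and n: "n \<ge> 1"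
  shows "{\<omega> \<in> space \<Omega>. large_form n (H \<omega>)} \<in> sets \<Omega>"
    and "measure \<Omega> {\<omega> \<in> space \<Omega>. large_form n (H \<omega>)} \<le> (1 / 4) ^ n"
proof -
  interpret prob_space \<Omega> using GUE by (simp add: is_GUE_def)
  have [measurable]: "H \<in> \<Omega> \<rightarrow>\<^sub>M hermitian_lebesgue n"
    using GUE by (auto simp: is_GUE_def dest: distributed_measurable)
  define E where "E = (\<lambda>(p, q). {\<omega> \<in> space \<Omega>.
     40 * real n \<le> herm_form n (H \<omega>) (\<lambda>i. gauss_int (p i)) (\<lambda>i. gauss_int (q i))})"
  let ?G = "gauss_net n \<times> gauss_net n"
  have E_sets: "E pq \<in> sets \<Omega>" for pq
    unfolding E_def by (cases pq) simp
  have union: "{\<omega> \<in> space \<Omega>. large_form n (H \<omega>)} = (\<Union>pq\<in>?G. E pq)"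
    by (auto simp: large_form_def E_def)
  have fin: "finite ?G" using gauss_net_card(1) by simp
  show "{\<omega> \<in> space \<Omega>. large_form n (H \<omega>)} \<in> sets \<Omega>"
    unfolding union using fin E_sets by blast
  have E_le: "measure \<Omega> (E pq) \<le> exp (- 22 * real n)" if pq_mem: "pq \<in> ?G" for pq
  proof -
    obtain p q where pq: "pq = (p, q)" and p: "p \<in> gauss_net n" and q: "q \<in> gauss_net n"
      using pq_mem by (metis SigmaE)
    let ?X = "\<lambda>\<omega>. herm_form n (H \<omega>) (\<lambda>i. gauss_int (p i)) (\<lambda>i. gauss_int (q i))"
    have "emeasure \<Omega> (E pq) \<le> ennreal (exp (- 1 * (40 * real n))) *
        (\<integral>\<^sup>+\<omega>. ennreal (exp (1 * ?X \<omega>)) * indicator (space \<Omega>) \<omega> \<partial>\<Omega>)"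
      unfolding E_def pq prod.case by (rule Chernoff_ineq_nn_integral_ge) auto
    also have "(\<integral>\<^sup>+\<omega>. ennreal (exp (1 * ?X \<omega>)) * indicator (space \<Omega>) \<omega> \<partial>\<Omega>) = (\<integral>\<^sup>+\<omega>. ennreal (exp (?X \<omega>)) \<partial>\<Omega>)"
      by (intro nn_integral_cong) simp
    also have "\<dots> \<le> ennreal (exp (sq_nrm n (\<lambda>i. gauss_int (p i)) * sq_nrm n (\<lambda>i. gauss_int (q i)) / (2 * real n)))"
      by (rule GUE_exp_moment[OF GUE n])
    also have "\<dots> \<le> ennreal (exp ((6 * real n) * (6 * real n) / (2 * real n)))"
      using p q by (intro ennreal_leI iffD2[OF exp_le_cancel_iff] divide_right_mono mult_mono)
         (auto simp: gauss_net_def)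
    also have "(6 * real n) * (6 * real n) / (2 * real n) = 18 * real n"
      using n by simp
    also have "ennreal (exp (- 1 * (40 * real n))) * ennreal (exp (18 * real n)) = ennreal (exp (- 22 * real n))"
      by (simp add: ennreal_mult'[symmetric] exp_add[symmetric])
    finally show ?thesis
      by (simp add: emeasure_eq_measure mult_left_mono)
  qed
  have "measure \<Omega> {\<omega> \<in> space \<Omega>. large_form n (H \<omega>)} \<le> (\<Sum>pq\<in>?G. measure \<Omega> (E pq))"
    unfolding union using fin E_sets by (intro measure_UNION_le) auto
  also have "\<dots> \<le> (\<Sum>pq\<in>?G. exp (- 22 * real n))"
    by (intro sum_mono E_le)
  also have "\<dots> = real (card (gauss_net n)) * real (card (gauss_net n)) * exp (- 22 * real n)"
    by (simp add: card_cartesian_product)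
  \<comment> \<open>Since \<open>exp 1\<close> is at least 2, each factor \<open>exp (- 22)\<close>
    is at most \<open>1 / 2 ^ 22\<close>, that is \<open>1 / 4194304\<close>; against
    \<open>2 ^ 20\<close> this leaves \<open>1 / 4\<close>.\<close>
  also have "\<dots> \<le> 1024 ^ n * 1024 ^ n * (1 / 4194304) ^ n"
  proof (intro mult_mono gauss_net_card)
    have "(2::real) ^ 22 \<le> exp 1 ^ 22"
      using exp_ge_add_one_self[of 1] by (intro power_mono) auto
    then have "exp (- 22) \<le> (1 / 4194304 :: real)"
      by (simp add: exp_of_nat_mult[symmetric] exp_minus field_simps)
    then have "exp (- 22) ^ n \<le> (1 / 4194304 :: real) ^ n"
      by (intro power_mono) auto
    then show "exp (- 22 * real n) \<le> (1 / 4194304) ^ n"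
      by (simp add: exp_of_nat_mult[symmetric] mult.commute)
  qed auto
  also have "\<dots> = (1 / 4) ^ n"
    by (simp add: power_mult_distrib[symmetric])
  finally show "measure \<Omega> {\<omega> \<in> space \<Omega>. large_form n (H \<omega>)} \<le> (1 / 4) ^ n" .
qed

section \<open>The shifted point\<close>

text \<open>Rests on \<open>2 * s * |w| <= s^2 + w^2\<close>. The free parameter \<open>s\<close> is
  later taken as \<open>sqrt t\<close>, which balances the two terms after integration.\<close>

lemma abs_divide_sum_squares_le:
  fixes w y s :: real
  assumes "s > 0"
  shows "\<bar>w\<bar> / (w\<^sup>2 + y\<^sup>2) \<le> 1 / (2 * s) + s / 2 * (1 / (w\<^sup>2 + y\<^sup>2))"
proof (cases "w\<^sup>2 + y\<^sup>2 = 0")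
  case False
  then have pos: "w\<^sup>2 + y\<^sup>2 > 0"
    by (simp add: sum_power2_gt_zero_iff)
  have "2 * s * \<bar>w\<bar> \<le> s\<^sup>2 + w\<^sup>2"
    using zero_le_power2[of "s - \<bar>w\<bar>"] by (simp add: power2_diff)
  also have "\<dots> \<le> (w\<^sup>2 + y\<^sup>2) + s\<^sup>2" by simp
  finally have *: "2 * s * \<bar>w\<bar> \<le> (w\<^sup>2 + y\<^sup>2) + s\<^sup>2" .
  define D where "D = w\<^sup>2 + y\<^sup>2"
  have "2 * s * (\<bar>w\<bar> / D) \<le> (D + s\<^sup>2) / D"
      using * pos by (simp add: D_def divide_right_mono)
  then show ?thesis
    using pos assms unfolding D_def[symmetric] by (simp add: field_simps power2_eq_square)
\<comment> \<open>With vanishing denominator both quotients are 0 by convention, and the bound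
  reduces to \<open>0 <= 1 / (2 * s)\<close>.\<close>
qed (use assms in simp)

lemma x_star_t_bound:
  assumes "prob_space \<mu>" and "\<psi> \<in> borel_measurable borel" and nonneg: "\<And>u. \<psi> u \<ge> 0"
    and \<mu>: "\<mu> = density lborel (\<lambda>u. ennreal (\<psi> u))" and t: "t > 0"
  shows "\<bar>x_star_t t \<mu> \<psi> x - x\<bar> \<le> sqrt t"
proof -
  interpret prob_space \<mu> by fact
  note assms(2)[measurable]
  have sets_\<mu> [measurable_cong]: "sets \<mu> = sets borel" by (simp add: \<mu>)
  define S where "S = {y. y > 0 \<and> (\<integral>s. 1 / ((x - s)\<^sup>2 + y\<^sup>2) \<partial>\<mu>) \<le> 1 / t}"
  define F where "F y u = \<bar>x - u\<bar> / ((x - u)\<^sup>2 + y\<^sup>2)" for y u :: real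
  have int: "integrable \<mu> (\<lambda>s. 1 / ((x - s)\<^sup>2 + y\<^sup>2))" if "y > 0" for y
  proof (rule integrable_const_bound)
    show "AE s in \<mu>. norm (1 / ((x - s)\<^sup>2 + y\<^sup>2)) \<le> 1 / y\<^sup>2"
      using that by (intro AE_I2) (simp add: frac_le)
  qed measurable
  have F_le: "(\<integral>\<^sup>+u. F y u \<partial>\<mu>) \<le> ennreal (1 / sqrt t)" if "y \<in> S" for y
  proof -
    from that have y: "y > 0" and le: "(\<integral>s. 1 / ((x - s)\<^sup>2 + y\<^sup>2) \<partial>\<mu>) \<le> 1 / t"
      by (auto simp: S_def)
    have int': "integrable \<mu> (\<lambda>u. 1 / (2 * sqrt t) + sqrt t / 2 * (1 / ((x - u)\<^sup>2 + y\<^sup>2)))"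
      by (intro Bochner_Integration.integrable_add integrable_mult_right int y) simp
    have "(\<integral>\<^sup>+u. F y u \<partial>\<mu>) \<le> (\<integral>\<^sup>+u. ennreal (1 / (2 * sqrt t) + sqrt t / 2 * (1 / ((x - u)\<^sup>2 + y\<^sup>2))) \<partial>\<mu>)"
      unfolding F_def using t by (intro nn_integral_mono ennreal_leI abs_divide_sum_squares_le) simp
    also have "\<dots> = ennreal (\<integral>u. 1 / (2 * sqrt t) + sqrt t / 2 * (1 / ((x - u)\<^sup>2 + y\<^sup>2)) \<partial>\<mu>)"
      using t by (intro nn_integral_eq_integral int' AE_I2) simp
    also have "(\<integral>u. 1 / (2 * sqrt t) + sqrt t / 2 * (1 / ((x - u)\<^sup>2 + y\<^sup>2)) \<partial>\<mu>)
        = 1 / (2 * sqrt t) + sqrt t / 2 * (\<integral>u. 1 / ((x - u)\<^sup>2 + y\<^sup>2) \<partial>\<mu>)"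
      by (subst Bochner_Integration.integral_add[OF _ integrable_mult_right[OF int[OF y]]])
         (simp_all add: prob_space del: times_divide_eq_right)
    also have "\<dots> \<le> 1 / (2 * sqrt t) + sqrt t / 2 * (1 / t)"
      using le t by (intro add_left_mono mult_left_mono) auto
    also have "\<dots> = 1 / sqrt t"
      using t by (simp add: field_simps real_sqrt_mult_self)
    finally show ?thesis by (simp add: ennreal_leI)
  qed
  \<comment> \<open>For \<open>y = sqrt t\<close> the integrand is already at most
    \<open>1 / t\<close>, so the set is nonempty and its infimum is a limit of members.\<close>
  have "sqrt t \<in> S"
  proof -
    have "(\<integral>s. 1 / ((x - s)\<^sup>2 + (sqrt t)\<^sup>2) \<partial>\<mu>) \<le> (\<integral>s. 1 / t \<partial>\<mu>)"
      using t by (intro integral_mono int) (auto simp: frac_le)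
    then show ?thesis using t by (simp add: S_def prob_space)
  qed
  moreover have "bdd_below S" by (rule bdd_belowI[of _ 0]) (auto simp: S_def)
  ultimately have "Inf S \<in> closure S"
    by (intro closure_contains_Inf) auto
  then obtain y where yS: "\<And>k. y k \<in> S" and ylim: "y \<longlonglongrightarrow> Inf S"
    unfolding closure_sequential by blast
  have Inf_S: "y_fun t \<mu> x = Inf S"
    by (simp add: y_fun_def S_def)
  \<comment> \<open>At \<open>u = x\<close> the numerator vanishes, so convergence holds there even
    if the infimum is 0.\<close>
  have F_lim: "(\<lambda>k. ennreal (F (y k) u)) \<longlonglongrightarrow> ennreal (F (Inf S) u)" for u
  proof (cases "u = x")
    case False
    then have "(x - u)\<^sup>2 + (Inf S)\<^sup>2 \<noteq> 0" by (simp add: sum_power2_eq_zero_iff)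
    then show ?thesis
      unfolding F_def by (intro tendsto_ennrealI tendsto_intros ylim)
  qed (simp add: F_def)
  have "(\<integral>\<^sup>+u. F (Inf S) u \<partial>\<mu>) = (\<integral>\<^sup>+u. liminf (\<lambda>k. ennreal (F (y k) u)) \<partial>\<mu>)"
    by (intro nn_integral_cong lim_imp_Liminf[OF _ F_lim, symmetric]) simp
  also have "\<dots> \<le> liminf (\<lambda>k. \<integral>\<^sup>+u. ennreal (F (y k) u) \<partial>\<mu>)"
    by (rule nn_integral_liminf) (simp add: F_def)
  also have "\<dots> \<le> liminf (\<lambda>k. ennreal (1 / sqrt t))"
    using F_le[OF yS] by (intro Liminf_mono always_eventually) blast
  also have "\<dots> = ennreal (1 / sqrt t)"
    by (simp add: Liminf_const)
  finally have fatou: "(\<integral>\<^sup>+u. F (Inf S) u \<partial>\<mu>) \<le> ennreal (1 / sqrt t)" .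
  define g where "g u = (x - u) * \<psi> u / ((x - u)\<^sup>2 + (Inf S)\<^sup>2)" for u
  have "(\<integral>\<^sup>+u. norm (g u) \<partial>lborel) = (\<integral>\<^sup>+u. F (Inf S) u \<partial>\<mu>)"
    unfolding \<mu> using nonneg
    by (subst nn_integral_density)
       (auto simp: F_def g_def abs_mult ennreal_mult'[symmetric] mult.commute intro!: nn_integral_cong)
  \<comment> \<open>If \<open>g\<close> is not integrable, its integral is 0 by convention and the
    bound is trivial.\<close>
  then have "ennreal (norm (\<integral>u. g u \<partial>lborel)) \<le> ennreal (1 / sqrt t)"
    using integral_norm_bound_ennreal[of lborel g] fatou
    by (cases "integrable lborel g") (auto simp: not_integrable_integral_eq)
  then have "\<bar>\<integral>u. g u \<partial>lborel\<bar> \<le> 1 / sqrt t"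
    using t by simp
  then have "t * \<bar>\<integral>u. g u \<partial>lborel\<bar> \<le> t * (1 / sqrt t)"
    using t by (intro mult_left_mono) auto
  then show ?thesis
    using t by (simp add: x_star_t_def Inf_S g_def[symmetric] abs_mult real_div_sqrt)
qed

section \<open>The spectrum of the deformed matrix\<close>

lemma det_char_matrix_sum:
  fixes A :: "complex mat"
  assumes C: "A \<in> carrier_mat n n"
  shows "det (char_matrix A z)
    = (\<Sum>p | p permutes {0..<n}. signof p * (\<Prod>i = 0..<n. A $$ (i, p i) - (if i = p i then z else 0)))"
proof -
  have "p i < n" if "p permutes {0..<n}" "i < n" for p i
    using permutes_in_image[OF that(1), of i] that(2) by simp
  then show ?thesis
    using C unfolding det_def'[OF char_matrix_closed[OF C]]
    by (intro sum.cong refl arg_cong2[where f = "(*)"] prod.cong) (auto simp: char_matrix_def)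
qed

text \<open>The expansion over permutations makes the determinant a polynomial in the
  entries.\<close>

lemma measurable_det_char_matrix:
  fixes A :: "'a \<Rightarrow> complex mat"
  assumes A: "\<And>\<omega>. \<omega> \<in> space N \<Longrightarrow> A \<omega> \<in> carrier_mat n n"
    and entries: "\<And>i j. i < n \<Longrightarrow> j < n \<Longrightarrow> (\<lambda>\<omega>. A \<omega> $$ (i, j)) \<in> borel_measurable N"
  shows "(\<lambda>\<omega>. det (char_matrix (A \<omega>) z)) \<in> borel_measurable N"
proof -
  have perm: "p i < n" if "p permutes {0..<n}" "i < n" for p i
    using permutes_in_image[OF that(1), of i] that(2) by simp
  have "(\<lambda>\<omega>. \<Sum>p | p permutes {0..<n}. signof p * (\<Prod>i = 0..<n. A \<omega> $$ (i, p i) - (if i = p i then z else 0)))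
      \<in> borel_measurable N"
    by (intro borel_measurable_sum borel_measurable_times borel_measurable_prod borel_measurable_diff
        borel_measurable_const entries) (auto intro: perm)
  then show ?thesis by (subst measurable_cong[OF det_char_matrix_sum[OF A]])
qed

lemma continuous_det_char_matrix:
  assumes A: "A \<in> carrier_mat n n"
  shows "continuous_on UNIV (\<lambda>x. det (char_matrix A (complex_of_real x)))"
proof -
  have "continuous_on UNIV (\<lambda>x. if b then complex_of_real x else 0)" for b
    by (cases b) (auto intro!: continuous_intros)
  then show ?thesis
    unfolding det_char_matrix_sum[OF A] by (intro continuous_intros)
qed

text \<open>Replaces an uncountable quantifier by countable ones. On a compact interval a
  nonvanishing continuous function stays away from 0 by some \<open>inverse (Suc k)\<close>;
  conversely such a bound at the rational points excludes zeros by density.\<close>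

lemma no_zero_in_interval_measurable:
  fixes F :: "'a \<Rightarrow> real \<Rightarrow> complex"
  assumes F [measurable]: "\<And>x. (\<lambda>\<omega>. F \<omega> x) \<in> borel_measurable N"
    and cont: "\<And>\<omega>. \<omega> \<in> space N \<Longrightarrow> continuous_on UNIV (F \<omega>)"
    and "\<alpha> < \<beta>"
  shows "{\<omega> \<in> space N. \<forall>x\<in>{\<alpha>..\<beta>}. F \<omega> x \<noteq> 0} \<in> sets N"
proof -
  have "(\<forall>x\<in>{\<alpha>..\<beta>}. F \<omega> x \<noteq> 0) \<longleftrightarrow>
      (\<exists>k::nat. \<forall>q::rat. \<alpha> \<le> of_rat q \<and> of_rat q \<le> \<beta> \<longrightarrow> inverse (Suc k) \<le> cmod (F \<omega> (of_rat q)))"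
    if \<omega>: "\<omega> \<in> space N" for \<omega>
  proof
    assume nz: "\<forall>x\<in>{\<alpha>..\<beta>}. F \<omega> x \<noteq> 0"
    have "continuous_on {\<alpha>..\<beta>} (\<lambda>x. cmod (F \<omega> x))"
      using continuous_on_subset[OF cont[OF \<omega>]] by (intro continuous_intros) auto
    then obtain x0 where x0: "x0 \<in> {\<alpha>..\<beta>}" "\<And>x. x \<in> {\<alpha>..\<beta>} \<Longrightarrow> cmod (F \<omega> x0) \<le> cmod (F \<omega> x)"
      using continuous_attains_inf[of "{\<alpha>..\<beta>}" "\<lambda>x. cmod (F \<omega> x)"] \<open>\<alpha> < \<beta>\<close> by auto
    then obtain k where "inverse (Suc k) < cmod (F \<omega> x0)"
      using nz reals_Archimedean[of "cmod (F \<omega> x0)"] by auto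
    then show "\<exists>k::nat. \<forall>q::rat. \<alpha> \<le> of_rat q \<and> of_rat q \<le> \<beta> \<longrightarrow> inverse (Suc k) \<le> cmod (F \<omega> (of_rat q))"
      using x0(2) by (intro exI[of _ k]) (force intro: order.trans[OF less_imp_le])
  next
    assume "\<exists>k::nat. \<forall>q::rat. \<alpha> \<le> of_rat q \<and> of_rat q \<le> \<beta> \<longrightarrow> inverse (Suc k) \<le> cmod (F \<omega> (of_rat q))"
    then obtain k :: nat where k: "\<And>q::rat. \<alpha> \<le> of_rat q \<Longrightarrow> of_rat q \<le> \<beta> \<Longrightarrow> inverse (Suc k) \<le> cmod (F \<omega> (of_rat q))"
      by blast
    show "\<forall>x\<in>{\<alpha>..\<beta>}. F \<omega> x \<noteq> 0"
    proof
      fix x assume x: "x \<in> {\<alpha>..\<beta>}"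
      show "F \<omega> x \<noteq> 0"
      proof
        assume zero: "F \<omega> x = 0"
        have "isCont (F \<omega>) x" using cont[OF \<omega>] by (simp add: continuous_on_eq_continuous_at)
        then obtain d where d: "d > 0" "\<And>y. dist y x < d \<Longrightarrow> dist (F \<omega> y) (F \<omega> x) < inverse (Suc k)"
          unfolding continuous_at_eps_delta by (metis inverse_positive_iff_positive of_nat_0_less_iff zero_less_Suc)
        \<comment> \<open>Here \<open>\<alpha> < \<beta>\<close> enters: even if \<open>x\<close> is
          an endpoint, a nondegenerate interval near \<open>x\<close> lies inside
          \<open>{\<alpha>..\<beta>}\<close> and contains a rational.\<close>
        have "max \<alpha> (x - d) < min \<beta> (x + d)" using x d(1) \<open>\<alpha> < \<beta>\<close> by auto
        then obtain q where q: "max \<alpha> (x - d) < of_rat q" "of_rat q < min \<beta> (x + d)"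
          using of_rat_dense by blast
        then have "cmod (F \<omega> (of_rat q)) < inverse (Suc k)"
          using d(2)[of "of_rat q"] by (simp add: dist_real_def zero abs_less_iff)
        then show False using k[of q] q by auto
      qed
    qed
  qed
  then have "{\<omega> \<in> space N. \<forall>x\<in>{\<alpha>..\<beta>}. F \<omega> x \<noteq> 0} = {\<omega> \<in> space N.
      \<exists>k::nat. \<forall>q::rat. \<alpha> \<le> of_rat q \<and> of_rat q \<le> \<beta> \<longrightarrow> inverse (Suc k) \<le> cmod (F \<omega> (of_rat q))}"
    by blast
  also have "\<dots> \<in> sets N" by measurable
  finally show ?thesis .
qed

lemma GUE_matrix_measurable:
  assumes "is_GUE n \<Omega> H"
  shows "H \<in> \<Omega> \<rightarrow>\<^sub>M hermitian_borel n"
    and "\<omega> \<in> space \<Omega> \<Longrightarrow> H \<omega> \<in> carrier_mat n n"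
proof -
  have "H \<in> \<Omega> \<rightarrow>\<^sub>M hermitian_lebesgue n"
    using assms by (auto simp: is_GUE_def dest: distributed_measurable)
  then show *: "H \<in> \<Omega> \<rightarrow>\<^sub>M hermitian_borel n"
    by (simp add: hermitian_lebesgue_def)
  assume "\<omega> \<in> space \<Omega>"
  from measurable_space[OF * this] show "H \<omega> \<in> carrier_mat n n"
    by (simp add: hermitian_borel_def hermitian_mats_iff)
qed

lemma no_eigenvalue_event_measurable:
  assumes GUE: "is_GUE n \<Omega> H" and M: "M \<in> carrier_mat n n" and "\<alpha> < \<beta>"
  shows "{\<omega> \<in> space \<Omega>. \<not> (\<exists>z\<in>{\<alpha>..\<beta>}. eigenvalue (M + c \<cdot>\<^sub>m H \<omega>) (complex_of_real z))} \<in> sets \<Omega>"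
proof -
  note H = GUE_matrix_measurable[OF GUE]
  have C: "M + c \<cdot>\<^sub>m H \<omega> \<in> carrier_mat n n" if "\<omega> \<in> space \<Omega>" for \<omega>
    using M H(2)[OF that] by simp
  have meas: "(\<lambda>\<omega>. (M + c \<cdot>\<^sub>m H \<omega>) $$ (i, j)) \<in> borel_measurable \<Omega>" if ij: "i < n" "j < n" for i j
  proof -
    have "(\<lambda>\<omega>. M $$ (i, j) + c * H \<omega> $$ (i, j)) \<in> borel_measurable \<Omega>"
      using measurable_compose[OF H(1) measurable_hermitian_entry[OF ij]] by measurable
    moreover have "(M + c \<cdot>\<^sub>m H \<omega>) $$ (i, j) = M $$ (i, j) + c * H \<omega> $$ (i, j)" if "\<omega> \<in> space \<Omega>" for \<omega>
      using H(2)[OF that] ij by simp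
    ultimately show ?thesis by (simp cong: measurable_cong)
  qed
  have "{\<omega> \<in> space \<Omega>. \<forall>z\<in>{\<alpha>..\<beta>}. det (char_matrix (M + c \<cdot>\<^sub>m H \<omega>) (complex_of_real z)) \<noteq> 0} \<in> sets \<Omega>"
    using \<open>\<alpha> < \<beta>\<close> C meas
    by (intro no_zero_in_interval_measurable measurable_det_char_matrix[where n = n]
        continuous_det_char_matrix[where n = n]) auto
  also have "{\<omega> \<in> space \<Omega>. \<forall>z\<in>{\<alpha>..\<beta>}. det (char_matrix (M + c \<cdot>\<^sub>m H \<omega>) (complex_of_real z)) \<noteq> 0}
      = {\<omega> \<in> space \<Omega>. \<not> (\<exists>z\<in>{\<alpha>..\<beta>}. eigenvalue (M + c \<cdot>\<^sub>m H \<omega>) (complex_of_real z))}"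
    using eigenvalue_det[OF C] by auto
  finally show ?thesis .
qed

text \<open>An eigenvector \<open>v\<close> satisfies \<open>(M - z) v = - s H v\<close>. The
  distance \<open>d\<close> from the spectrum gives \<open>d |v| <= s |H v|\<close>, so
  \<open>40 |v| <= |H v|\<close>. Pairing \<open>H v\<close> with \<open>v\<close>, both scaled to
  squared length \<open>n\<close>, and rounding to the net gives the claim.\<close>

lemma eigenvalue_imp_large_form:
  assumes M: "M \<in> hermitian_mats n" and ev: "eigenvalues_listed M n a"
    and H: "H \<in> carrier_mat n n" and n: "n \<ge> 1" and s: "s > 0" and d: "40 * s \<le> d"
    and gap: "\<And>k. k < n \<Longrightarrow> d \<le> \<bar>a k - z\<bar>"
    and eig: "eigenvalue (M + complex_of_real s \<cdot>\<^sub>m H) (complex_of_real z)"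
  shows "large_form n H"
proof -
  have C: "M \<in> carrier_mat n n" using M by (simp add: hermitian_mats_iff)
  from eig obtain v where v: "v \<in> carrier_vec n" and v0: "v \<noteq> 0\<^sub>v n"
    and eq: "(M + complex_of_real s \<cdot>\<^sub>m H) *\<^sub>v v = complex_of_real z \<cdot>\<^sub>v v"
    using C H by (auto simp: eigenvalue_def eigenvector_def)
  define w where "w = H *\<^sub>v v"
  have w: "w \<in> carrier_vec n" using H v by (simp add: w_def)
  have resid: "(M *\<^sub>v v) $ i - complex_of_real z * v $ i = - complex_of_real s * w $ i" if i: "i < n" for i
  proof -
    have "((M + complex_of_real s \<cdot>\<^sub>m H) *\<^sub>v v) $ i = (M *\<^sub>v v) $ i + complex_of_real s * w $ i"
      unfolding w_def mat_vec_index[OF C v i] mat_vec_index[OF H v i]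
      using mat_vec_index[of "M + complex_of_real s \<cdot>\<^sub>m H" n v i] C H v i
      by (simp add: sum.distrib sum_distrib_left algebra_simps)
    then show ?thesis using v i by (simp add: eq algebra_simps)
  qed
  have "d \<le> cmod (e - complex_of_real z)" if "eigenvalue M e" for e
  proof -
    have "poly (char_poly M) e = 0" using that eigenvalue_root_char_poly[OF C] by simp
    then obtain k where "k < n" "e = complex_of_real (a k)"
      using ev by (auto simp: eigenvalues_listed_def poly_prod)
    then show ?thesis using gap[of k] by (simp flip: of_real_diff)
  qed
  then have "d\<^sup>2 * sq_nrm n (vec_index v) \<le> sq_nrm n (\<lambda>i. (M *\<^sub>v v) $ i - complex_of_real z * v $ i)"
    using n d s by (intro hermitian_shift_lower_bound[OF M _ _ _ v]) auto
  also have "\<dots> = s\<^sup>2 * sq_nrm n (vec_index w)"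
    by (simp add: sq_nrm_def resid norm_mult power_mult_distrib sum_distrib_left)
  finally have le: "d\<^sup>2 * sq_nrm n (vec_index v) \<le> s\<^sup>2 * sq_nrm n (vec_index w)" .
  define V where "V = sqrt (sq_nrm n (vec_index v))"
  define W where "W = sqrt (sq_nrm n (vec_index w))"
  have V2: "sq_nrm n (vec_index v) = V\<^sup>2" and W2: "sq_nrm n (vec_index w) = W\<^sup>2"
    by (simp_all add: V_def W_def)
  have V: "V > 0"
  proof -
    have "V \<noteq> 0"
    proof
      assume "V = 0"
      then have "(\<Sum>i<n. (cmod (v $ i))\<^sup>2) = 0" using V2 by (simp add: sq_nrm_def)
      then have "\<forall>i<n. v $ i = 0" by (subst (asm) sum_nonneg_eq_0_iff) auto
      then have "v = 0\<^sub>v n" using v by (intro eq_vecI) auto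
      with v0 show False ..
    qed
    moreover have "V \<ge> 0" by (simp add: V_def)
    ultimately show ?thesis by simp
  qed
  have W0: "W \<ge> 0" by (simp add: W_def)
  have "(d * V)\<^sup>2 \<le> (s * W)\<^sup>2" using le by (simp add: V2 W2 power_mult_distrib)
  then have "d * V \<le> s * W" using s W0 by (intro power2_le_imp_le[of "d * V" "s * W"]) auto
  moreover have "40 * s * V \<le> d * V" using d V by simp
  ultimately have "s * (40 * V) \<le> s * W" by simp
  then have WV: "40 * V \<le> W" using s by simp
  then have W: "W > 0" using V by simp
  \<comment> \<open>With \<open>u1\<close> parallel to \<open>H v\<close>, the form at
    \<open>u1\<close> and \<open>v1\<close> equals \<open>n |H v| / |v|\<close>.\<close>
  define u1 where "u1 i = complex_of_real (sqrt (real n) / W) * w $ i" for i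
  define v1 where "v1 i = complex_of_real (sqrt (real n) / V) * v $ i" for i
  have scale: "sq_nrm n (\<lambda>i. complex_of_real r * f i) = r\<^sup>2 * sq_nrm n f" for r f
    by (simp add: sq_nrm_def norm_mult power_mult_distrib sum_distrib_left)
  have u1: "sq_nrm n u1 \<le> real n" and v1: "sq_nrm n v1 \<le> real n"
    using V W unfolding u1_def v1_def scale by (simp_all add: V2 W2 power_divide)
  have "herm_form n H u1 v1 = Re (\<Sum>i<n. cnj (u1 i) * (\<Sum>j<n. H $$ (i, j) * v1 j))"
    by (simp add: herm_form_def sum_distrib_left mult.assoc)
  also have "\<dots> = Re (\<Sum>i<n. complex_of_real (sqrt (real n) / W * (sqrt (real n) / V)) * complex_of_real ((cmod (w $ i))\<^sup>2))"
  proof (intro arg_cong[where f = Re] sum.cong refl)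
    fix i assume "i \<in> {..<n}"
    then have "(\<Sum>j<n. H $$ (i, j) * v1 j) = complex_of_real (sqrt (real n) / V) * w $ i"
      by (simp add: v1_def w_def mat_vec_index[OF H v] sum_distrib_left mult.left_commute del: of_real_divide)
    then show "cnj (u1 i) * (\<Sum>j<n. H $$ (i, j) * v1 j)
        = complex_of_real (sqrt (real n) / W * (sqrt (real n) / V)) * complex_of_real ((cmod (w $ i))\<^sup>2)"
      by (simp only: complex_norm_square of_real_mult u1_def complex_cnj_mult complex_cnj_complex_of_real mult_ac)
  qed
  also have "\<dots> = sqrt (real n) / W * (sqrt (real n) / V) * sq_nrm n (vec_index w)"
    by (simp add: sq_nrm_def sum_distrib_left flip: of_real_power of_real_mult)
  also have "\<dots> = real n * (W / V)"
    using V W by (simp add: W2 power2_eq_square)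
  finally have "herm_form n H u1 v1 = real n * (W / V)" .
  moreover have "real n * 40 \<le> real n * (W / V)"
    using WV V by (intro mult_left_mono) (auto simp: field_simps)
  ultimately have "40 * real n \<le> herm_form n H u1 v1" by simp
  with herm_form_le_net[OF u1 v1, of H] show ?thesis
    unfolding large_form_def by (meson order.trans)
qed

theorem corollary1p1:
  fixes M :: "nat \<Rightarrow> complex mat"
    and a :: "nat \<Rightarrow> nat \<Rightarrow> real"
    and \<mu> :: "real measure"
    and \<psi> :: "real \<Rightarrow> real"
    and \<Omega> :: "nat \<Rightarrow> 'w measure"
    and H :: "nat \<Rightarrow> 'w \<Rightarrow> complex mat"
    and \<delta> \<epsilon> t :: "nat \<Rightarrow> real"
    and x :: real
  assumes M_hermitian: "\<And>n. n \<ge> 1 \<Longrightarrow> M n \<in> hermitian_mats n"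
    and M_eigenvalues: "\<And>n. n \<ge> 1 \<Longrightarrow> eigenvalues_listed (M n) n (a n)"
    and A1: "assumption_1 (\<lambda>n. empirical_measure n (a n)) \<mu> \<psi>"
    and A2: "assumption_2 a"
    and GUE: "\<And>n. n \<ge> 1 \<Longrightarrow> is_GUE n (\<Omega> n) (H n)"
    and \<delta>_pos: "\<And>n. n \<ge> 1 \<Longrightarrow> \<delta> n > 0"
    and \<delta>_lim: "\<delta> \<longlonglongrightarrow> 0"
    and \<delta>_large: "filterlim (\<lambda>n. real n * (\<delta> n)\<^sup>2) at_top sequentially"
    and gap: "\<And>n k. n \<ge> 1 \<Longrightarrow> k < n \<Longrightarrow> a n k \<notin> {x - \<delta> n .. x + \<delta> n}"
    and \<epsilon>_pos: "\<And>n. n \<ge> 1 \<Longrightarrow> \<epsilon> n > 0"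
    and \<epsilon>_small: "\<epsilon> \<in> o(\<delta>)"
    and t_pos: "\<And>n. n \<ge> 1 \<Longrightarrow> t n > 0"
    and t_small: "t \<in> o(\<lambda>n. (\<delta> n)\<^sup>2)"
  shows "(\<lambda>n. measure (\<Omega> n) {\<omega> \<in> space (\<Omega> n).
            \<not> (\<exists>z \<in> {x_star_t (t n) \<mu> \<psi> x - \<epsilon> n .. x_star_t (t n) \<mu> \<psi> x + \<epsilon> n}.
                 eigenvalue (M n + complex_of_real (sqrt (t n)) \<cdot>\<^sub>m H n \<omega>) (complex_of_real z))})
         \<longlonglongrightarrow> 1"
proof -
  define E where "E n = {\<omega> \<in> space (\<Omega> n).
            \<not> (\<exists>z \<in> {x_star_t (t n) \<mu> \<psi> x - \<epsilon> n .. x_star_t (t n) \<mu> \<psi> x + \<epsilon> n}.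
                 eigenvalue (M n + complex_of_real (sqrt (t n)) \<cdot>\<^sub>m H n \<omega>) (complex_of_real z))}" for n
  \<comment> \<open>The constants 1/4 and 1/80 make half-width plus shift at most
    \<open>\<delta> n / 4 + \<delta> n / 80\<close>, hence below \<open>\<delta> n / 2\<close>, and
    give \<open>40 * sqrt (t n) <= \<delta> n / 2\<close>.\<close>
  have "eventually (\<lambda>n. norm (\<epsilon> n) \<le> 1 / 4 * norm (\<delta> n)) sequentially"
    using \<epsilon>_small by (rule landau_o.smallD) simp
  moreover have "eventually (\<lambda>n. norm (t n) \<le> (1 / 80)\<^sup>2 * norm ((\<delta> n)\<^sup>2)) sequentially"
    using t_small by (rule landau_o.smallD) simp
  moreover have "eventually (\<lambda>n::nat. n \<ge> 1) sequentially" by (rule eventually_ge_at_top)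
  ultimately have bounds: "eventually (\<lambda>n. 1 - (1 / 4) ^ n \<le> measure (\<Omega> n) (E n) \<and> measure (\<Omega> n) (E n) \<le> 1) sequentially"
  proof eventually_elim
    case (elim n)
    then have n: "n \<ge> 1" by simp
    note G = GUE[OF n]
    interpret prob_space "\<Omega> n" using G by (simp add: is_GUE_def)
    have \<epsilon>: "\<epsilon> n \<le> \<delta> n / 4" using elim \<epsilon>_pos[OF n] \<delta>_pos[OF n] by simp
    have "t n \<le> (\<delta> n / 80)\<^sup>2" using elim t_pos[OF n] by (simp add: power_divide)
    then have s: "sqrt (t n) \<le> \<delta> n / 80"
      using \<delta>_pos[OF n] by (intro real_le_lsqrt) auto
    have xt: "\<bar>x_star_t (t n) \<mu> \<psi> x - x\<bar> \<le> sqrt (t n)"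
      using A1 t_pos[OF n] by (intro x_star_t_bound) (auto simp: assumption_1_def)
    \<comment> \<open>Monotonicity below relies on measurability: \<open>measure\<close> is 0 by
      convention on sets outside the sigma-algebra.\<close>
    have E_sets: "E n \<in> sets (\<Omega> n)"
      unfolding E_def using M_hermitian[OF n] \<epsilon>_pos[OF n]
      by (intro no_eigenvalue_event_measurable[OF G]) (auto simp: hermitian_mats_iff)
    let ?B = "{\<omega> \<in> space (\<Omega> n). large_form n (H n \<omega>)}"
    have "space (\<Omega> n) - ?B \<subseteq> E n"
    proof
      fix \<omega> assume \<omega>: "\<omega> \<in> space (\<Omega> n) - ?B"
      have "\<not> eigenvalue (M n + complex_of_real (sqrt (t n)) \<cdot>\<^sub>m H n \<omega>) (complex_of_real z)"
        if z: "z \<in> {x_star_t (t n) \<mu> \<psi> x - \<epsilon> n .. x_star_t (t n) \<mu> \<psi> x + \<epsilon> n}" for z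
      proof
        assume eig: "eigenvalue (M n + complex_of_real (sqrt (t n)) \<cdot>\<^sub>m H n \<omega>) (complex_of_real z)"
        have "\<bar>z - x_star_t (t n) \<mu> \<psi> x\<bar> \<le> \<epsilon> n" using z by auto
        then have "\<bar>z - x\<bar> \<le> \<delta> n / 2"
          using xt s \<epsilon> \<delta>_pos[OF n] by linarith
        \<comment> \<open>Each \<open>a n k\<close> is farther than \<open>\<delta> n\<close> from
          \<open>x\<close>, while \<open>z\<close> is within half that distance.\<close>
        then have "\<delta> n / 2 \<le> \<bar>a n k - z\<bar>" if "k < n" for k
          using gap[OF n that] unfolding atLeastAtMost_iff by linarith
        then have "large_form n (H n \<omega>)"
          using s \<omega> t_pos[OF n]
          by (intro eigenvalue_imp_large_form[OF M_hermitian[OF n] M_eigenvalues[OF n]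
                GUE_matrix_measurable(2)[OF G] n _ _ _ eig, where d = "\<delta> n / 2"]) auto
        then show False using \<omega> by simp
      qed
      then show "\<omega> \<in> E n" using \<omega> by (auto simp: E_def)
    qed
    then have "prob (space (\<Omega> n) - ?B) \<le> prob (E n)"
      using E_sets by (rule finite_measure_mono)
    then show ?case
      using GUE_large_form[OF G n] prob_compl[of ?B] by simp
  qed
  have "(\<lambda>n. measure (\<Omega> n) (E n)) \<longlonglongrightarrow> 1"
  proof (rule tendsto_sandwich)
    have "(\<lambda>n. 1 - (1 / 4 :: real) ^ n) \<longlonglongrightarrow> 1 - 0"
      by (intro tendsto_intros LIMSEQ_power_zero) simp
    then show "(\<lambda>n. 1 - (1 / 4 :: real) ^ n) \<longlonglongrightarrow> 1" by simp
  qed (use bounds in \<open>auto elim: eventually_mono\<close>)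
  then show ?thesis by (simp only: E_def)
qed

end
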